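(* Let $r\geq 2$ be an integer, let $h:\mathbb{Z}_{\geq 1}\to\mathbb{C}$ satisfy $|h(d)|\ll d^\alpha$ for some $\alpha\in\left[0,\frac{1}{2r-1}\right]$, and define $f:\mathbb{Z}_{\geq1}\to\mathbb{C}$ by $f(n)=h(d)$ if $n=d^r$ for a positive integer $d$, and $f(n)=0$ otherwise. Suppose there exists an exponent pair $(k,\ell)$ such that $\ell = rk$. Then, for $x\geq 2$, \[ \sum_{n\leq x} f\left(\left\lfloor\frac{x}{n}\right\rfloor\right) = C_f x + O\left(x^{\frac{\alpha}{r+1}+\frac{k}{k+1}}\log x + x^{\frac{1+\alpha}{2r}}\right), \qquad C_f=\sum_{n=1}^\infty\frac{f(n)}{n(n+1)}, \] where the factor $\log x$ is present only when $\alpha=0$ (i.e. for $\alpha>0$ the error term is $O\big(x^{\frac{\alpha}{r+1}+\frac{k}{k+1}} + x^{\frac{1+\alpha}{2r}}\big)$).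
   Context: $\lfloor t\rfloor$ denotes the integer part of $t$; $e(t)=e^{2\pi i t}$. Implied constants may depend on $r$, $h$, and the exponent pair. Exponent pair (standard definition, as in Graham–Kolesnik): for $s>0$, $N\ge1$, $y>0$, an integer $P\ge1$ and $\varepsilon>0$, let $\mathcal{F}(N,P,s,y,\varepsilon)$ be the set of real functions $g$ on an interval $I\subseteq(N,2N]$ with $P$ continuous derivatives satisfying $|g^{(j+1)}(t)-(-1)^j (s)_j\, y\, t^{-s-j}|\le \varepsilon\,(s)_j\, y\, t^{-s-j}$ for $0\le j\le P-1$, $t\in I$, where $(s)_j=s(s+1)\cdots(s+j-1)$. A pair $(k,\ell)$ with $0\le k\le \tfrac12\le \ell\le 1$ is an exponent pair if for every $s>0$ there exist $P$ and $\varepsilon>0$ such that for all $N\ge1$, $y>0$, intervals $I\subseteq(N,2N]$ and $g\in\mathcal{F}(N,P,s,y,\varepsilon)$, \[ \sum_{n\in I} e(g(n)) \ll (yN^{-s})^k N^\ell + y^{-1}N^{s}, \] with implied constant depending only on $k,\ell,s$. *)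

theory Defs
  imports "HOL-Analysis.Analysis"
begin

definition e :: "real \<Rightarrow> complex" where
  "e t = exp (2 * complex_of_real pi * \<i> * complex_of_real t)"

definition in_F :: "real \<Rightarrow> nat \<Rightarrow> real \<Rightarrow> real \<Rightarrow> real \<Rightarrow> real set \<Rightarrow> (real \<Rightarrow> real) \<Rightarrow> bool" where
  "in_F N P s y \<epsilon> I g \<longleftrightarrow>
     (\<exists>G :: nat \<Rightarrow> real \<Rightarrow> real.
        (\<forall>t\<in>I. G 0 t = g t) \<and>
        (\<forall>j\<le>P. continuous_on I (G j)) \<and>
        (\<forall>j<P. \<forall>t\<in>I. (G j has_real_derivative G (Suc j) t) (at t within I)) \<and>
        (\<forall>j<P. \<forall>t\<in>I.
            \<bar>G (Suc j) t - (-1)^j * pochhammer s j * y * t powr (- s - real j)\<bar>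
              \<le> \<epsilon> * pochhammer s j * y * t powr (- s - real j)))"

definition exponent_pair :: "real \<Rightarrow> real \<Rightarrow> bool" where
  "exponent_pair k l \<longleftrightarrow>
     0 \<le> k \<and> k \<le> 1/2 \<and> 1/2 \<le> l \<and> l \<le> 1 \<and>
     (\<forall>s>0. \<exists>P::nat. P \<ge> 1 \<and> (\<exists>\<epsilon>>0. \<exists>C::real.
        \<forall>N y I g. N \<ge> 1 \<longrightarrow> y > 0 \<longrightarrow> is_interval I \<longrightarrow> I \<subseteq> {N<..2*N} \<longrightarrow>
          in_F N P s y \<epsilon> I g \<longrightarrow>
          norm (\<Sum>n\<in>{n::int. real_of_int n \<in> I}. e (g (real_of_int n)))
            \<le> C * ((y * N powr (- s)) powr k * N powr l + N powr s / y)))"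

end

theory Submission
  imports Defs
begin

text \<open>
  Let \<open>c d\<close> be the number of \<open>n\<close> with \<open>\<lfloor>x / n\<rfloor> = d ^ r\<close>, so that the sum is \<open>\<Sum>d. h d * c d\<close>, and \<open>c d\<close>
  differs from \<open>x / (d ^ r * (d ^ r + 1))\<close> by at most \<open>1\<close>. For \<open>d \<le> x powr (1 / (2 * r))\<close> this is used as it
  stands. For larger \<open>d\<close> the main terms are negligible, and it suffices to bound \<open>c\<close> from above. Up to
  \<open>d = x powr (1 / (r + 1))\<close> one counts, in dyadic blocks, the \<open>d\<close> for which \<open>x / d ^ r\<close> is very close to an
  integer; beyond that point \<open>n \<le> x powr (1 / (r + 1))\<close>, and one counts the \<open>n\<close> for which
  \<open>(x / n) powr (1 / r)\<close> is very close to an integer. Both counts concern values of a monomial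
  \<open>c * t powr (- \<sigma>)\<close>; a Fejer kernel argument reduces them to exponential sums, to which the exponent pair
  applies. The condition \<open>l = r * k\<close> makes the first count independent of the block.
\<close>

subsection \<open>Monomials close to integers\<close>

definition near_int :: "real \<Rightarrow> real \<Rightarrow> bool" where
  "near_int \<delta> t \<longleftrightarrow> (\<exists>m::int. \<bar>t - of_int m\<bar> \<le> \<delta>)"

lemma near_int_mono: "near_int \<delta> t \<Longrightarrow> \<delta> \<le> \<delta>' \<Longrightarrow> near_int \<delta>' t"
  unfolding near_int_def by (meson order_trans)

section \<open>Exponential sums over monomials\<close>

lemma e_add: "e (a + b) = e a * e b"
  by (simp add: e_def exp_add [symmetric] algebra_simps)

lemma cnj_e: "cnj (e t) = e (- t)"
  by (simp add: e_def exp_cnj)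

lemma Re_e: "Re (e t) = cos (2 * pi * t)"
  by (simp add: e_def Re_exp)

lemma e_of_int [simp]: "e (of_int m) = 1"
  using exp_integer_2pi[of "of_int m"] by (simp add: e_def mult_ac)

text \<open>The definition of \<open>in_F\<close> compares the derivative of \<open>g\<close> with
  \<open>y * t powr (- s)\<close>. For \<open>s = \<sigma> + 1\<close> the function here has exactly
  this derivative, so all deviations are zero and every \<open>P\<close> and every positive
  \<open>\<epsilon>\<close> is admissible.\<close>

lemma in_F_powr:
  assumes "\<sigma> > 0" "y > 0" "\<epsilon> > 0" "I \<subseteq> {0<..}"
  shows "in_F N P (\<sigma> + 1) y \<epsilon> I (\<lambda>t. - (y / \<sigma>) * t powr (- \<sigma>))"
proof -
  define G where "G = (\<lambda>j::nat. case j of 0 \<Rightarrow> (\<lambda>t. - (y / \<sigma>) * t powr (- \<sigma>))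
    | Suc i \<Rightarrow> (\<lambda>t. (-1)^i * pochhammer (\<sigma> + 1) i * y * t powr (- (\<sigma> + 1) - real i)))"
  have der: "(G j has_real_derivative G (Suc j) t) (at t within I)" if "t \<in> I" for j t
  proof -
    have t: "t > 0" using that assms by auto
    show ?thesis
    proof (cases j)
      case 0
      then show ?thesis using t assms(1)
        by (auto simp: G_def intro!: derivative_eq_intros simp: powr_diff powr_minus field_simps powr_add)
    next
      case (Suc i)
      have *: "((\<lambda>t. (-1)^i * pochhammer (\<sigma> + 1) i * y * t powr (- (\<sigma> + 1) - real i))
        has_real_derivative (-1)^i * pochhammer (\<sigma> + 1) i * y *
          ((- (\<sigma> + 1) - real i) * t powr (- (\<sigma> + 1) - real i - 1))) (at t within I)"
        using t by (intro DERIV_cmult has_field_derivative_at_within[OF has_real_derivative_powr])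
      show ?thesis
        unfolding Suc G_def nat.case
        by (rule DERIV_cong [OF *]) (simp add: pochhammer_Suc algebra_simps)
    qed
  qed
  have "continuous_on I (G j)" for j
    by (rule DERIV_continuous_on[OF der])
  moreover have "\<bar>G (Suc j) t - (-1)^j * pochhammer (\<sigma> + 1) j * y * t powr (- (\<sigma> + 1) - real j)\<bar>
              \<le> \<epsilon> * pochhammer (\<sigma> + 1) j * y * t powr (- (\<sigma> + 1) - real j)" for j t
    using assms by (auto simp: G_def intro!: mult_nonneg_nonneg pochhammer_nonneg)
  ultimately show ?thesis
    unfolding in_F_def using der by (intro exI[of _ G]) (auto simp: G_def)
qed

text \<open>The pair is applied with \<open>s = \<sigma> + 1\<close> and
  \<open>y = \<sigma> * c\<close>. The model function is then the negative of
  \<open>c * t powr (- \<sigma>)\<close>, and complex conjugation reverses the sign without changing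
  the norm. Uniformity in \<open>c\<close> matters because frequencies will be absorbed into
  \<open>c\<close>.\<close>

lemma exponent_pair_powr_sum:
  assumes "exponent_pair k l" "\<sigma> > 0"
  shows "\<exists>C\<ge>0. \<forall>N\<ge>1. \<forall>c>0. norm (\<Sum>n | N < real n \<and> real n \<le> 2 * N. e (c * real n powr (- \<sigma>)))
     \<le> C * ((c * N powr (- \<sigma> - 1)) powr k * N powr l + N powr (\<sigma> + 1) / c)"
proof -
  have "\<sigma> + 1 > 0" using assms(2) by simp
  with assms(1) obtain P \<epsilon> C where P: "\<epsilon> > 0" and
    C: "\<forall>N y I g. N \<ge> 1 \<longrightarrow> y > 0 \<longrightarrow> is_interval I \<longrightarrow> I \<subseteq> {N<..2*N} \<longrightarrow>
          in_F N P (\<sigma> + 1) y \<epsilon> I g \<longrightarrow>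
          norm (\<Sum>n\<in>{n::int. real_of_int n \<in> I}. e (g (real_of_int n)))
            \<le> C * ((y * N powr (- (\<sigma> + 1))) powr k * N powr l + N powr (\<sigma> + 1) / y)"
    unfolding exponent_pair_def by blast
  \<comment> \<open>The factors \<open>\<sigma> powr k\<close> and \<open>1 / \<sigma>\<close> come
    from \<open>y = \<sigma> * c\<close> in the two terms of the bound; their sum majorises each of
    them.\<close>
  define K where "K = \<bar>C\<bar> * (\<sigma> powr k + 1 / \<sigma>)"
  have "norm (\<Sum>n | N < real n \<and> real n \<le> 2 * N. e (c * real n powr (- \<sigma>)))
     \<le> K * ((c * N powr (- \<sigma> - 1)) powr k * N powr l + N powr (\<sigma> + 1) / c)"
    if N: "N \<ge> 1" and c: "c > 0" for N c
  proof -
    define U where "U = (c * N powr (- \<sigma> - 1)) powr k * N powr l"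
    define V where "V = N powr (\<sigma> + 1) / c"
    have UV: "U \<ge> 0" "V \<ge> 0" using c by (auto simp: U_def V_def)
    \<comment> \<open>The redundant \<open>\<sigma> * c / \<sigma>\<close> has the shape
      \<open>y / \<sigma>\<close> of \<open>in_F_powr\<close>; the index changes from
      \<open>nat\<close> to the \<open>int\<close> used by \<open>exponent_pair\<close>.\<close>
    have eq: "(\<Sum>n | N < real n \<and> real n \<le> 2 * N. e (- (c * real n powr (- \<sigma>)))) =
        (\<Sum>n\<in>{n::int. real_of_int n \<in> {N<..2*N}}. e (- (\<sigma> * c / \<sigma>) * real_of_int n powr (- \<sigma>)))"
      using N assms(2) by (intro sum.reindex_bij_witness[of _ nat int]) auto
    have "norm (\<Sum>n | N < real n \<and> real n \<le> 2 * N. e (c * real n powr (- \<sigma>)))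
      = norm (cnj (\<Sum>n | N < real n \<and> real n \<le> 2 * N. e (c * real n powr (- \<sigma>))))"
      by (rule complex_mod_cnj[symmetric])
    also have "\<dots> = norm (\<Sum>n\<in>{n::int. real_of_int n \<in> {N<..2*N}}. e (- (\<sigma> * c / \<sigma>) * real_of_int n powr (- \<sigma>)))"
      unfolding eq[symmetric] by (simp add: cnj_e)
    also have "\<dots> \<le> C * ((\<sigma> * c * N powr (- (\<sigma> + 1))) powr k * N powr l + N powr (\<sigma> + 1) / (\<sigma> * c))"
      using N c assms(2) P by (intro C[rule_format] in_F_powr) (auto simp: is_interval_1)
    also have "\<dots> = C * (\<sigma> powr k * U + (1 / \<sigma>) * V)"
      using c assms(2) by (simp add: U_def V_def powr_mult mult_ac)
    also have "\<dots> \<le> \<bar>C\<bar> * ((\<sigma> powr k + 1 / \<sigma>) * U + (\<sigma> powr k + 1 / \<sigma>) * V)"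
      using UV assms(2) by (intro mult_mono add_mono mult_right_mono) auto
    also have "\<dots> = K * (U + V)"
      unfolding K_def mult.assoc by (simp only: distrib_left)
    finally show ?thesis by (simp add: U_def V_def)
  qed
  moreover have "K \<ge> 0" using assms(2) by (simp add: K_def)
  ultimately show ?thesis by blast
qed

section \<open>From exponential sums to counting values near integers\<close>

text \<open>Each phase \<open>m * u\<close> with \<open>m < H\<close> is within \<open>1 / 6\<close>
  of an integer, so each term has real part at least \<open>cos (pi / 3) = 1 / 2\<close> and nothing
  cancels. This explains the 6 in the tolerance.\<close>

lemma norm_geometric_e_ge:
  assumes "H \<ge> 1" "near_int (1 / (6 * real H)) u"
  shows "real H / 2 \<le> norm (\<Sum>m<H. e (real m * u))"
proof -
  obtain z :: int where z: "\<bar>u - of_int z\<bar> \<le> 1 / (6 * real H)"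
    using assms by (auto simp: near_int_def)
  have "1 / 2 \<le> Re (e (real m * u))" if "m < H" for m
  proof -
    define v where "v = real m * (u - of_int z)"
    have "\<bar>v\<bar> = real m * \<bar>u - of_int z\<bar>" by (simp add: v_def abs_mult)
    also have "\<dots> \<le> real H * (1 / (6 * real H))" using that z by (intro mult_mono) auto
    also have "\<dots> = 1 / 6" using assms by simp
    finally have v: "\<bar>v\<bar> \<le> 1 / 6" .
    have "e (real m * u) = e (v + of_int (int m * z))" by (simp add: v_def algebra_simps)
    also have "\<dots> = e v" unfolding e_add e_of_int by simp
    finally have "Re (e (real m * u)) = cos \<bar>2 * pi * v\<bar>" by (simp add: Re_e)
    also have "\<dots> \<ge> cos (pi / 3)"
      using v by (intro cos_monotone_0_pi_le) (auto simp: abs_mult field_simps)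
    finally show ?thesis by (simp add: cos_60)
  qed
  then have "(\<Sum>m<H. 1 / 2) \<le> (\<Sum>m<H. Re (e (real m * u)))" by (intro sum_mono) auto
  also have "\<dots> = Re (\<Sum>m<H. e (real m * u))" by simp
  also have "\<dots> \<le> norm (\<Sum>m<H. e (real m * u))" by (rule complex_Re_le_cmod)
  finally show ?thesis by simp
qed

text \<open>The squared modulus of a geometric sum of length \<open>H\<close> is a Fejer kernel: it
  contains only the frequencies \<open>m - m'\<close>, all below \<open>H\<close> in absolute value.
  Frequency 0 contributes \<open>card A\<close>, every other one at most \<open>B\<close>.\<close>

lemma card_near_int_le:
  assumes A: "finite A" and H: "H \<ge> 1" and "B \<ge> 0"
    and B: "\<And>h. 1 \<le> h \<Longrightarrow> h < H \<Longrightarrow> norm (\<Sum>n\<in>A. e (real h * u n)) \<le> B"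
  shows "real (card {n\<in>A. near_int (1 / (6 * real H)) (u n)}) \<le> 4 * real (card A) / real H + 4 * B"
proof -
  define T where "T = (\<lambda>n. \<Sum>m<H. e (real m * u n))"
  define W where "W = {n\<in>A. near_int (1 / (6 * real H)) (u n)}"
  have off: "norm (\<Sum>n\<in>A. e ((real m - real m') * u n)) \<le> B" if "m < H" "m' < H" "m \<noteq> m'" for m m'
  proof (cases "m' < m")
    case True
    then show ?thesis using B[of "m - m'"] that by (simp add: of_nat_diff)
  next
    case False
    \<comment> \<open>The frequency is negative; conjugation turns it into \<open>m' - m\<close>, to
      which the hypothesis applies.\<close>
    have "norm (\<Sum>n\<in>A. e ((real m - real m') * u n)) = norm (cnj (\<Sum>n\<in>A. e ((real m - real m') * u n)))"
      by (rule complex_mod_cnj[symmetric])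
    also have "\<dots> = norm (\<Sum>n\<in>A. e ((real m' - real m) * u n))"
      by (simp only: cnj_sum cnj_e) (simp add: algebra_simps)
    finally show ?thesis using B[of "m' - m"] that False by (simp add: of_nat_diff)
  qed
  \<comment> \<open>Compare the second moment of \<open>T\<close> over \<open>A\<close> with its diagonal: \<open>T\<close> is at least \<open>H / 2\<close> on \<open>W\<close>.\<close>
  have "real (card W) * (real H / 2)^2 = (\<Sum>n\<in>W. (real H / 2)^2)" by simp
  also have "\<dots> \<le> (\<Sum>n\<in>W. (norm (T n))^2)"
    unfolding T_def by (intro sum_mono power_mono norm_geometric_e_ge) (use H in \<open>auto simp: W_def\<close>)
  also have "\<dots> \<le> (\<Sum>n\<in>A. (norm (T n))^2)"
    using A by (intro sum_mono2) (auto simp: W_def)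
  also have "\<dots> = norm (\<Sum>n\<in>A. complex_of_real ((norm (T n))^2))"
    unfolding of_real_sum [symmetric] norm_of_real by (simp add: sum_nonneg)
  also have "(\<Sum>n\<in>A. complex_of_real ((norm (T n))^2)) =
      (\<Sum>n\<in>A. \<Sum>m<H. \<Sum>m'<H. e ((real m - real m') * u n))"
    unfolding complex_norm_square
    by (simp add: T_def sum_product cnj_e e_add[symmetric] algebra_simps)
  also have "\<dots> = (\<Sum>m<H. \<Sum>n\<in>A. \<Sum>m'<H. e ((real m - real m') * u n))"
    by (rule sum.swap)
  also have "\<dots> = (\<Sum>m<H. \<Sum>m'<H. \<Sum>n\<in>A. e ((real m - real m') * u n))"
    by (intro sum.cong refl sum.swap)
  also have "norm \<dots> \<le> (\<Sum>m<H. \<Sum>m'<H. B + (if m = m' then real (card A) else 0))"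
  proof (intro sum_norm_le)
    fix m m' assume "m \<in> {..<H}" "m' \<in> {..<H}"
    then show "norm (\<Sum>n\<in>A. e ((real m - real m') * u n)) \<le> B + (if m = m' then real (card A) else 0)"
      using off[of m m'] \<open>B \<ge> 0\<close> e_of_int[of 0] by auto
  qed
  also have "\<dots> = real H ^ 2 * B + real H * real (card A)"
    by (simp add: sum.distrib power2_eq_square algebra_simps)
  finally have "real (card W) * real H ^ 2 \<le> 4 * (real H ^ 2 * B + real H * real (card A))"
    by (simp add: power_divide)
  then have "real (card W) \<le> 4 * (real H ^ 2 * B + real H * real (card A)) / real H ^ 2"
    using H by (simp add: pos_le_divide_eq)
  also have "\<dots> = 4 * real (card A) / real H + 4 * B"
    using H by (simp add: field_simps power2_eq_square)
  finally show ?thesis by (simp add: W_def)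
qed

lemma finite_nat_block [simp]: "finite {n. N < real n \<and> real n \<le> M}"
  by (rule finite_subset[of _ "{..nat \<lfloor>M\<rfloor>}"]) (auto simp: le_nat_floor)

lemma card_dyadic_block_le:
  assumes "N \<ge> 1"
  shows "real (card {n. N < real n \<and> real n \<le> 2 * N}) \<le> 2 * N"
proof -
  have "card {n. N < real n \<and> real n \<le> 2 * N} \<le> card {1..nat \<lfloor>2 * N\<rfloor>}"
    using assms by (intro card_mono) (auto simp: le_nat_floor)
  then show ?thesis using assms by simp linarith
qed

text \<open>The three terms are the expected number of hits, the exponent pair bound optimised over
  the number of frequencies, and its secondary term. Since \<open>K\<close> is uniform in
  \<open>N\<close>, \<open>c\<close> and \<open>\<delta>\<close>, the bound can be summed over
  dyadic blocks with a tolerance that varies from block to block.\<close>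

lemma card_near_int_powr_le:
  assumes ep: "exponent_pair k l" and \<sigma>: "\<sigma> > 0"
  shows "\<exists>K\<ge>0. \<forall>N\<ge>1. \<forall>c>0. \<forall>\<delta>\<ge>0.
    real (card {n. N < real n \<and> real n \<le> 2 * N \<and> near_int \<delta> (c * real n powr (- \<sigma>))})
     \<le> K * (N * \<delta> + N powr ((k + l) / (k + 1)) * (c * N powr (- \<sigma> - 1)) powr (k / (k + 1))
          + N powr (\<sigma> + 1) / c)"
proof -
  have k: "k \<ge> 0" using ep by (simp add: exponent_pair_def)
  obtain C where C0: "C \<ge> 0" and C: "\<And>N c. N \<ge> 1 \<Longrightarrow> c > 0 \<Longrightarrow>
     norm (\<Sum>n | N < real n \<and> real n \<le> 2 * N. e (c * real n powr (- \<sigma>)))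
     \<le> C * ((c * N powr (- \<sigma> - 1)) powr k * N powr l + N powr (\<sigma> + 1) / c)"
    using exponent_pair_powr_sum[OF assms] by blast
  have "real (card {n. N < real n \<and> real n \<le> 2 * N \<and> near_int \<delta> (c * real n powr (- \<sigma>))})
     \<le> (96 + 4 * C) * (N * \<delta> + N powr ((k + l) / (k + 1)) * (c * N powr (- \<sigma> - 1)) powr (k / (k + 1))
          + N powr (\<sigma> + 1) / c)" (is "real (card ?W) \<le> _")
    if N: "N \<ge> 1" and c: "c > 0" and \<delta>: "\<delta> \<ge> 0" for N c \<delta>
  proof -
    define Y where "Y = c * N powr (- \<sigma> - 1)"
    have Y: "Y > 0" using c N by (simp add: Y_def)
    \<comment> \<open>The exponent pair bound with frequencies up to \<open>H\<close> is balanced against \<open>N / H\<close> at \<open>H = N / B\<close>.\<close>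
    define B where "B = N powr ((k + l) / (k + 1)) * Y powr (k / (k + 1))"
    define V where "V = N powr (\<sigma> + 1) / c"
    have V: "V \<ge> 0" using c by (simp add: V_def)
    have B: "B > 0" using N Y by (simp add: B_def)
    \<comment> \<open>\<open>B\<close> solves
      \<open>B powr (k + 1) = N powr (k + l) * Y powr k\<close>; it is the size of the main term at
      frequency \<open>N / B\<close>.\<close>
    have balance: "(N / B * Y) powr k * N powr l = B"
    proof -
      have "N / B * Y = N powr (1 - (k + l) / (k + 1)) * Y powr (1 - k / (k + 1))"
        using N Y by (simp add: B_def powr_diff)
      then have "(N / B * Y) powr k * N powr l
         = N powr ((1 - (k + l) / (k + 1)) * k + l) * Y powr ((1 - k / (k + 1)) * k)"
        by (simp add: powr_mult powr_powr powr_add)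
      also have "(1 - (k + l) / (k + 1)) * k + l = (k + l) / (k + 1)" using k by (simp add: field_simps)
      also have "(1 - k / (k + 1)) * k = k / (k + 1)" using k by (simp add: field_simps)
      finally show ?thesis by (simp add: B_def)
    qed
    define A where "A = {n. N < real n \<and> real n \<le> 2 * N}"
    have A: "finite A" "real (card A) \<le> 2 * N"
      using card_dyadic_block_le[OF N] by (auto simp: A_def)
    have W: "?W \<subseteq> A" by (auto simp: A_def)
    \<comment> \<open>Raising the tolerance to at least \<open>B / (6 * N)\<close> forces
      \<open>H \<le> N / B\<close> below, at the price of \<open>B / 6\<close> in
      \<open>N * R\<close>; \<open>\<delta> \<le> R\<close> keeps every counted
      \<open>n\<close>.\<close>
    define R where "R = max \<delta> (B / (6 * N))"
    have R: "\<delta> \<le> R" "B / (6 * N) \<le> R" "N * R \<le> N * \<delta> + B / 6"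
      using B N \<delta> by (auto simp: R_def max_def)
    have "0 < B / (6 * N)" using B N by simp
    with R have R0: "R > 0" by linarith
    have "real (card ?W) \<le> 96 * (N * \<delta> + B / 6) + 4 * C * (B + V)"
    \<comment> \<open>For \<open>R > 1 / 6\<close> no \<open>H \<ge> 1\<close> fits below
      \<open>1 / (6 * R)\<close>, and the trivial count suffices. Otherwise 96 arises as
      \<open>4 * 2 * 12\<close>: the factor 4 of \<open>card_near_int_le\<close>, the block size
      \<open>2 * N\<close>, and \<open>1 / H \<le> 12 * R\<close>.\<close>
    proof (cases "R > 1 / 6")
      case True
      have "real (card ?W) \<le> real (card A)"
        using W A by (simp add: card_mono)
      also have "\<dots> \<le> 2 * N" by fact
      also have "\<dots> \<le> 96 * (N * R)" using True N by simp
      also have "\<dots> \<le> 96 * (N * \<delta> + B / 6)" using R by simp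
      also have "\<dots> \<le> \<dots> + 4 * C * (B + V)" using C0 B V by simp
      finally show ?thesis .
    next
      case False
      define H where "H = nat \<lfloor>1 / (6 * R)\<rfloor>"
      have ge1: "1 / (6 * R) \<ge> 1" using False R R0 by simp
      then have H1: "H \<ge> 1" by (simp add: H_def le_nat_floor)
      have H2: "real H \<le> 1 / (6 * R)" unfolding H_def by (rule of_nat_floor) (use ge1 in linarith)
      \<comment> \<open>Rounding down loses at most a factor 2, because
        \<open>H \<ge> 1\<close>.\<close>
      have "1 / (6 * R) < real H + 1" using ge1 unfolding H_def by linarith
      then have H3: "1 / (6 * R) \<le> 2 * real H" using H1 by linarith
      have H4: "1 / real H \<le> 12 * R" using H3 H1 R R0 by (simp add: field_simps)
      have H5: "R \<le> 1 / (6 * real H)" using H2 H1 R R0 by (simp add: field_simps)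
      have "real H \<le> N / B"
      proof -
        have "1 / (6 * R) \<le> 1 / (6 * (B / (6 * N)))" using R R0 B N by (intro divide_left_mono) auto
        also have "\<dots> = N / B" using N by simp
        finally show ?thesis using H2 by linarith
      qed
      then have HB: "real h * Y \<le> N / B * Y" if "h < H" for h
        using that Y by (intro mult_right_mono) auto
      have bd: "norm (\<Sum>n\<in>A. e (real h * (c * real n powr (- \<sigma>)))) \<le> C * (B + V)"
        if h: "1 \<le> h" "h < H" for h
      proof -
        have "norm (\<Sum>n\<in>A. e (real h * (c * real n powr (- \<sigma>)))) \<le>
          C * ((real h * c * N powr (- \<sigma> - 1)) powr k * N powr l + N powr (\<sigma> + 1) / (real h * c))"
          using C[of N "real h * c"] N c h by (simp add: A_def mult.assoc)
        also have "\<dots> \<le> C * (B + V)"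
        proof (intro mult_left_mono add_mono C0)
          have "(real h * c * N powr (- \<sigma> - 1)) powr k * N powr l \<le> (N / B * Y) powr k * N powr l"
            using HB[OF h(2)] Y k by (intro mult_right_mono powr_mono2) (auto simp: Y_def mult.assoc)
          then show "(real h * c * N powr (- \<sigma> - 1)) powr k * N powr l \<le> B"
            by (simp only: balance)
          \<comment> \<open>The secondary term decreases with the frequency, so \<open>h = 1\<close>
            is the worst case.\<close>
          show "N powr (\<sigma> + 1) / (real h * c) \<le> V"
            unfolding V_def using h c by (intro divide_left_mono) auto
        qed
        finally show ?thesis .
      qed
      have "?W \<subseteq> {n\<in>A. near_int (1 / (6 * real H)) (c * real n powr (- \<sigma>))}"
        using R(1) H5 by (auto simp: A_def elim!: near_int_mono)
      from card_mono[OF _ this] A(1) have "real (card ?W) \<le> real (card {n\<in>A. near_int (1 / (6 * real H)) (c * real n powr (- \<sigma>))})"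
        by simp
      also have "\<dots> \<le> 4 * real (card A) / real H + 4 * (C * (B + V))"
        using A H1 bd C0 B V by (intro card_near_int_le) auto
      also have "4 * real (card A) / real H \<le> 8 * N * (1 / real H)"
        using A H1 by (simp add: divide_right_mono)
      also have "8 * N * (1 / real H) \<le> 8 * N * (12 * R)"
        using H4 N by (intro mult_left_mono) auto
      also have "\<dots> = 96 * (N * R)" by simp
      also have "\<dots> \<le> 96 * (N * \<delta> + B / 6)" using R by simp
      finally show ?thesis by simp
    qed
    also have "\<dots> \<le> (96 + 4 * C) * (N * \<delta> + B + V)"
    proof -
      have "0 \<le> C * (N * \<delta>)" "0 \<le> C * B" "0 \<le> C * V" using C0 N \<delta> B V by auto
      then show ?thesis using B V by (simp add: algebra_simps)
    qed
    finally show ?thesis by (simp add: B_def V_def Y_def)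
  qed
  moreover have "96 + 4 * C \<ge> 0" using C0 by simp
  ultimately show ?thesis by blast
qed

subsection \<open>Dyadic decomposition\<close>

lemma sum_dyadic_blocks:
  fixes \<phi> :: "nat \<Rightarrow> real"
  assumes "a > 0"
  shows "(\<Sum>n | a < real n \<and> real n \<le> a * 2 ^ J. \<phi> n) =
    (\<Sum>j<J. \<Sum>n | a * 2 ^ j < real n \<and> real n \<le> 2 * (a * 2 ^ j). \<phi> n)"
proof (induction J)
  case (Suc J)
  have "a * 1 \<le> a * 2 ^ J" using assms by (intro mult_left_mono) auto
  then have "{n. a < real n \<and> real n \<le> a * 2 ^ Suc J} = {n. a < real n \<and> real n \<le> a * 2 ^ J} \<union>
    {n. a * 2 ^ J < real n \<and> real n \<le> 2 * (a * 2 ^ J)}" by auto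
  then have "(\<Sum>n | a < real n \<and> real n \<le> a * 2 ^ Suc J. \<phi> n) =
    (\<Sum>n | a < real n \<and> real n \<le> a * 2 ^ J. \<phi> n) +
    (\<Sum>n | a * 2 ^ J < real n \<and> real n \<le> 2 * (a * 2 ^ J). \<phi> n)"
    by (simp only:) (rule sum.union_disjoint, auto)
  with Suc.IH show ?case by simp
qed (auto intro!: sum.neutral)

text \<open>A geometric progression with ratio \<open>2 powr \<eta> > 1\<close> is dominated by its
  last term, up to a constant depending on \<open>\<eta>\<close> alone.\<close>

lemma sum_dyadic_powr_le:
  fixes \<eta> :: real
  assumes "\<eta> > 0"
  shows "\<exists>K\<ge>0. \<forall>a>0. \<forall>X J. (\<forall>j<J. a * 2 ^ j \<le> X) \<longrightarrow> (\<Sum>j<J. (a * 2 ^ j) powr \<eta>) \<le> K * X powr \<eta>"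
proof -
  define q :: real where "q = 2 powr \<eta>"
  have q: "q > 1" using assms by (simp add: q_def)
  have qj: "(2 ^ j) powr \<eta> = q ^ j" for j
    by (simp add: q_def powr_realpow[symmetric] powr_powr mult.commute)
  have "(\<Sum>j<J. (a * 2 ^ j) powr \<eta>) \<le> q / (q - 1) * X powr \<eta>"
    if a: "a > 0" and X: "\<forall>j<J. a * 2 ^ j \<le> X" for a X J
  proof (cases J)
    case (Suc i)
    have "(\<Sum>j<J. (a * 2 ^ j) powr \<eta>) = a powr \<eta> * (\<Sum>j<J. q ^ j)"
      using a by (simp add: powr_mult qj sum_distrib_left)
    also have "\<dots> = a powr \<eta> * ((q ^ J - 1) / (q - 1))"
      using q by (subst geometric_sum) auto
    also have "\<dots> \<le> a powr \<eta> * (q ^ J / (q - 1))"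
      using q by (intro mult_left_mono divide_right_mono) auto
    also have "\<dots> = q / (q - 1) * (a * 2 ^ i) powr \<eta>"
      using a by (simp add: Suc powr_mult qj)
    also have "\<dots> \<le> q / (q - 1) * X powr \<eta>"
      using q X a assms by (intro mult_left_mono powr_mono2) (auto simp: Suc)
    finally show ?thesis .
  qed (use q in auto)
  moreover have "q / (q - 1) \<ge> 0" using q by simp
  ultimately show ?thesis by blast
qed

text \<open>For positive \<open>\<alpha>\<close> the sum is geometric; for
  \<open>\<alpha> = 0\<close> it counts the blocks, of which there are O(log x). This is the only
  source of the logarithm in the theorem.\<close>

lemma sum_dyadic_powr_log_le:
  fixes \<alpha> :: real
  assumes "\<alpha> \<ge> 0"
  shows "\<exists>K\<ge>0. \<forall>a\<ge>1. \<forall>x\<ge>2. \<forall>X\<le>x. \<forall>J. (\<forall>j<J. a * 2 ^ j \<le> X) \<longrightarrow>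
    (\<Sum>j<J. (a * 2 ^ j) powr \<alpha>) \<le> K * X powr \<alpha> * (if \<alpha> = 0 then ln x else 1)"
proof (cases "\<alpha> = 0")
  case False
  then obtain K where "K \<ge> 0" "\<forall>a>0. \<forall>X J. (\<forall>j<J. a * 2 ^ j \<le> X) \<longrightarrow> (\<Sum>j<J. (a * 2 ^ j) powr \<alpha>) \<le> K * X powr \<alpha>"
    using sum_dyadic_powr_le[of \<alpha>] assms by auto
  then show ?thesis using False by (intro exI[of _ K]) auto
next
  case True
  have "(\<Sum>j<J. (a * 2 ^ j) powr \<alpha>) \<le> 2 / ln 2 * X powr \<alpha> * (if \<alpha> = 0 then ln x else 1)"
    if a: "a \<ge> 1" and x: "x \<ge> 2" "X \<le> x" and J: "\<forall>j<J. a * 2 ^ j \<le> X" for a x X :: real and J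
  proof (cases J)
    case (Suc i)
    have "1 * 2 ^ i \<le> a * 2 ^ i" using a by (intro mult_right_mono) auto
    moreover have "a * 2 ^ i \<le> X" using J Suc by simp
    ultimately have X: "2 ^ i \<le> X" by linarith
    moreover have "(0::real) < 2 ^ i" by simp
    ultimately have X0: "X > 0" by linarith
    have "real i * ln 2 = ln (2 ^ i)" by (simp add: ln_realpow)
    also have "\<dots> \<le> ln x" using X x X0 by (subst ln_le_cancel_iff) auto
    finally have "real i \<le> ln x / ln 2" by (simp add: pos_le_divide_eq)
    \<comment> \<open>The extra 1 in \<open>J = i + 1\<close> is absorbed here, by
      \<open>x \<ge> 2\<close>.\<close>
    moreover have "1 \<le> ln x / ln 2" using x by (simp add: pos_le_divide_eq)
    ultimately have "real J \<le> ln x / ln 2 + ln x / ln 2" unfolding Suc of_nat_Suc by linarith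
    then have "real J \<le> 2 / ln 2 * ln x" by simp
    then show ?thesis using True X0 a by simp
  qed (use True x in auto)
  moreover have "2 / ln 2 \<ge> (0::real)" by simp
  ultimately show ?thesis by blast
qed

text \<open>The least \<open>J\<close> that reaches \<open>X\<close> works: by minimality all
  earlier blocks start below \<open>X\<close>, as the two preceding summation lemmas
  require.\<close>

lemma dyadic_cover:
  fixes a X :: real
  assumes "a > 0"
  shows "\<exists>J. X \<le> a * 2 ^ J \<and> (\<forall>j<J. a * 2 ^ j \<le> X)"
proof -
  obtain n where "X / a < 2 ^ n" using real_arch_pow[of 2 "X / a"] by auto
  then have "X \<le> a * 2 ^ n" using assms by (simp add: field_simps)
  then show ?thesis
    by (intro exI[of _ "LEAST n. X \<le> a * 2 ^ n"]) (auto intro: LeastI dest: not_less_Least)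
qed

subsection \<open>Fibres of the floor quotient\<close>

text \<open>The \<open>c d\<close> of the overview is
  \<open>card (floor_fibre x (d ^ r))\<close>.\<close>

definition floor_fibre :: "real \<Rightarrow> nat \<Rightarrow> nat set" where
  "floor_fibre x q = {n \<in> {1..nat \<lfloor>x\<rfloor>}. nat \<lfloor>x / real n\<rfloor> = q}"

lemma finite_floor_fibre [simp]: "finite (floor_fibre x q)"
  by (simp add: floor_fibre_def)

lemma mem_floor_fibre_iff:
  assumes "q \<ge> 1" "x \<ge> 0"
  shows "n \<in> floor_fibre x q \<longleftrightarrow> n \<ge> 1 \<and> real n * real q \<le> x \<and> x < real n * (real q + 1)"
proof (cases "n \<ge> 1")
  case True
  have "nat \<lfloor>x / real n\<rfloor> = q \<longleftrightarrow> \<lfloor>x / real n\<rfloor> = int q" using assms by auto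
  also have "\<dots> \<longleftrightarrow> real n * real q \<le> x \<and> x < real n * (real q + 1)"
    using True by (simp add: floor_eq_iff field_simps)
  finally have *: "nat \<lfloor>x / real n\<rfloor> = q \<longleftrightarrow> real n * real q \<le> x \<and> x < real n * (real q + 1)" .
  have "n \<le> nat \<lfloor>x\<rfloor>" if "real n * real q \<le> x"
  proof -
    have "real n * 1 \<le> real n * real q" using assms by (intro mult_left_mono) auto
    with that show ?thesis by (simp add: le_nat_floor)
  qed
  then show ?thesis using True * by (auto simp: floor_fibre_def)
qed (auto simp: floor_fibre_def)

text \<open>The fibre consists of the integers above \<open>x / (q + 1)\<close> and up to
  \<open>x / q\<close>; the length of this interval is the main term, and the two floors cost at
  most 1.\<close>

lemma card_floor_fibre:
  assumes "q \<ge> 1" "x \<ge> 0"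
  shows "\<bar>real (card (floor_fibre x q)) - x / (real q * (real q + 1))\<bar> \<le> 1"
proof -
  define u where "u = x / real q"
  define v where "v = x / (real q + 1)"
  have uv: "0 \<le> v" "v \<le> u" using assms by (auto simp: u_def v_def intro!: divide_left_mono)
  have "floor_fibre x q = {nat \<lfloor>v\<rfloor><..nat \<lfloor>u\<rfloor>}"
  proof (rule set_eqI)
    fix n
    have "n \<in> floor_fibre x q \<longleftrightarrow> n \<ge> 1 \<and> real n \<le> u \<and> v < real n"
      using assms by (simp add: mem_floor_fibre_iff u_def v_def field_simps)
    also have "\<dots> \<longleftrightarrow> n \<in> {nat \<lfloor>v\<rfloor><..nat \<lfloor>u\<rfloor>}"
      using uv by (auto simp: le_nat_floor) linarith+
    finally show "n \<in> floor_fibre x q \<longleftrightarrow> n \<in> {nat \<lfloor>v\<rfloor><..nat \<lfloor>u\<rfloor>}" .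
  qed
  then have "card (floor_fibre x q) = nat \<lfloor>u\<rfloor> - nat \<lfloor>v\<rfloor>" by simp
  also have "real \<dots> = real_of_int \<lfloor>u\<rfloor> - real_of_int \<lfloor>v\<rfloor>"
    using uv floor_mono[OF uv(2)] by (simp add: of_nat_diff nat_mono)
  finally have "\<bar>real (card (floor_fibre x q)) - (u - v)\<bar> \<le> 1" by linarith
  moreover have "u - v = x / (real q * (real q + 1))"
    using assms by (simp add: u_def v_def field_simps)
  ultimately show ?thesis by simp
qed

text \<open>For \<open>x < q^2\<close> the interval that defines the fibre is shorter than 1, so it
  holds at most one integer. If it holds \<open>n\<close>, then
  \<open>0 \<le> x / q - n \<le> n / q \<le> x / q^2\<close>.\<close>

lemma card_floor_fibre_le_of_bool:
  assumes q: "q \<ge> 1" "x \<ge> 0" "x < (real q)^2"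
  shows "real (card (floor_fibre x q)) \<le> of_bool (near_int (x / (real q)^2) (x / real q))"
proof (cases "floor_fibre x q = {}")
  case False
  then obtain n where n: "n \<in> floor_fibre x q" by blast
  have "x / (real q * (real q + 1)) < 1"
    using q by (simp add: divide_less_eq power2_eq_square) (smt (verit) mult_left_mono of_nat_0_le_iff ring_distribs)
  then have "real (card (floor_fibre x q)) < 2" using card_floor_fibre[OF q(1,2)] by linarith
  then have "card (floor_fibre x q) \<le> 1" by linarith
  moreover have "near_int (x / (real q)^2) (x / real q)"
    unfolding near_int_def
  proof (intro exI[of _ "int n"])
    have le: "real n * real q \<le> x" and less: "x < real n * (real q + 1)"
      using n mem_floor_fibre_iff q by auto
    have n1: "real n \<le> x / real q" using le q by (simp add: field_simps)
    have "x / real q \<le> real n * (real q + 1) / real q" using less q by (intro divide_right_mono) auto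
    also have "\<dots> = real n + real n / real q" using q by (simp add: field_simps)
    finally have "x / real q - real n \<le> real n / real q" by simp
    also have "\<dots> \<le> (x / real q) / real q" using n1 q by (intro divide_right_mono) auto
    finally show "\<bar>x / real q - of_int (int n)\<bar> \<le> x / (real q)^2" using n1 by (simp add: power2_eq_square)
  qed
  ultimately show ?thesis by simp
qed auto

section \<open>The range of \<open>d\<close> between \<open>x powr (1 / (2 * r))\<close> and
  \<open>x powr (1 / (r + 1))\<close>\<close>

text \<open>For \<open>d\<close> near \<open>N\<close>, \<open>card_near_int_powr_le\<close> is
  applied to \<open>x * t powr (- r)\<close>. The tolerance term decays with \<open>N\<close>, so
  the first block dominates and yields the second error term; the exponent pair term is
  \<open>x powr (k / (k + 1))\<close> in every block; the secondary term stays at most 1 as long as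
  \<open>N powr (r + 1) \<le> x\<close>, which fixes the upper end of the range.\<close>

lemma sum_card_fibres_medium_le:
  fixes r :: nat and \<alpha> k :: real
  assumes r: "r \<ge> 2" and alpha: "0 \<le> \<alpha>" "\<alpha> \<le> 1" and ep: "exponent_pair k (real r * k)"
  shows "\<exists>K\<ge>0. \<forall>x\<ge>2.
    (\<Sum>d | x powr (1 / (2 * real r)) < real d \<and> real d \<le> x powr (1 / (real r + 1)).
        real d powr \<alpha> * real (card (floor_fibre x (d ^ r))))
    \<le> K * (x powr (\<alpha> / (real r + 1) + k / (k + 1)) * (if \<alpha> = 0 then ln x else 1)
         + x powr ((1 + \<alpha>) / (2 * real r)))"
proof -
  have k: "k \<ge> 0" using ep by (simp add: exponent_pair_def)
  define \<kappa> where "\<kappa> = k / (k + 1)"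
  have \<kappa>: "\<kappa> \<ge> 0" using k by (simp add: \<kappa>_def)
  obtain K where K0: "K \<ge> 0" and K: "\<And>N c \<delta>. N \<ge> 1 \<Longrightarrow> c > 0 \<Longrightarrow> \<delta> \<ge> 0 \<Longrightarrow>
    real (card {n. N < real n \<and> real n \<le> 2 * N \<and> near_int \<delta> (c * real n powr (- real r))})
     \<le> K * (N * \<delta> + N powr ((k + real r * k) / (k + 1)) * (c * N powr (- real r - 1)) powr (k / (k + 1))
          + N powr (real r + 1) / c)"
    using card_near_int_powr_le[OF ep, of "real r"] r by auto
  obtain K' where K'0: "K' \<ge> 0" and K': "\<And>a x X J. a \<ge> 1 \<Longrightarrow> x \<ge> 2 \<Longrightarrow> X \<le> x \<Longrightarrow>
    (\<forall>j<J. a * 2 ^ j \<le> X) \<Longrightarrow>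
    (\<Sum>j<J. (a * 2 ^ j) powr \<alpha>) \<le> K' * X powr \<alpha> * (if \<alpha> = 0 then ln x else 1)"
    using sum_dyadic_powr_log_le[OF alpha(1)] by metis
  have "(\<Sum>d | x powr (1 / (2 * real r)) < real d \<and> real d \<le> x powr (1 / (real r + 1)).
        real d powr \<alpha> * real (card (floor_fibre x (d ^ r))))
    \<le> 4 * K * (K' + 1) * (x powr (\<alpha> / (real r + 1) + k / (k + 1)) * (if \<alpha> = 0 then ln x else 1)
         + x powr ((1 + \<alpha>) / (2 * real r)))"
    if x: "x \<ge> 2" for x :: real
  proof -
    define D where "D = x powr (1 / (2 * real r))"
    define X where "X = x powr (1 / (real r + 1))"
    define L where "L = (if \<alpha> = 0 then ln x else 1)"
    have L: "L \<ge> 0" using x by (simp add: L_def)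
    have D1: "D \<ge> 1" using x by (simp add: D_def ge_one_powr_ge_zero)
    have Xx: "X \<le> x" using x powr_mono[of "1 / (real r + 1)" 1 x] by (simp add: X_def)
    have D2r: "D powr (2 * real r) = x" using x r by (simp add: D_def powr_powr)
    have Xr: "X powr (real r + 1) = x" using x r by (simp add: X_def powr_powr)
    obtain J where J: "X \<le> D * 2 ^ J" "\<forall>j<J. D * 2 ^ j \<le> X"
      using dyadic_cover[of D X] D1 by auto
    define \<phi> where "\<phi> = (\<lambda>d. real d powr \<alpha> * real (card (floor_fibre x (d ^ r))))"
    have block: "(\<Sum>n | D * 2 ^ j < real n \<and> real n \<le> 2 * (D * 2 ^ j). \<phi> n)
      \<le> 2 * K * (D powr (1 + \<alpha>) * (1/2) ^ j + 2 * x powr \<kappa> * (D * 2 ^ j) powr \<alpha>)" if j: "j < J" for j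
    proof -
      define N where "N = D * 2 ^ j"
      have "D * 1 \<le> N" unfolding N_def using D1 by (intro mult_left_mono) auto
      then have N: "D \<le> N" "1 \<le> N" using D1 by auto
      have NX: "N \<le> X" using J j by (simp add: N_def)
      \<comment> \<open>A tolerance that is constant on the block, so that only the exact monomial \<open>x / t ^ r\<close> occurs in
        the exponential sums, never its perturbation \<open>x / (t ^ r + 1)\<close>.\<close>
      define \<delta> where "\<delta> = x * N powr (- 2 * real r)"
      have dle: "\<phi> d \<le> (2 * N) powr \<alpha> * of_bool (near_int \<delta> (x * real d powr (- real r)))"
        if d: "N < real d" "real d \<le> 2 * N" for d
      proof -
        have d1: "real d > 0" using d N by linarith
        have dr: "real (d ^ r) = real d powr real r" using d1 by (simp add: powr_realpow)
        have dr2: "(real (d ^ r))^2 = real d powr (2 * real r)"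
          unfolding dr using d1 by (simp add: powr_powr powr_realpow[symmetric] mult.commute)
        \<comment> \<open>Since \<open>D powr (2 * real r) = x\<close>, every \<open>d\<close>
          beyond \<open>D\<close> satisfies \<open>x < (d ^ r)^2\<close>, so that its fibre has at
          most one element. This fixes the lower end of the range.\<close>
        have "D powr (2 * real r) < real d powr (2 * real r)"
          using D1 d N r by (intro powr_less_mono2) auto
        then have "x < (real (d ^ r))^2" unfolding dr2 using D2r by linarith
        then have "real (card (floor_fibre x (d ^ r))) \<le> of_bool (near_int (x / (real (d ^ r))^2) (x / real (d ^ r)))"
          using d1 x by (intro card_floor_fibre_le_of_bool) auto
        also have "\<dots> \<le> of_bool (near_int \<delta> (x * real d powr (- real r)))"
        proof -
          have "N powr (2 * real r) \<le> real d powr (2 * real r)"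
            using d N r by (intro powr_mono2) auto
          then have "x / (real (d ^ r))^2 \<le> \<delta>"
            unfolding dr2 \<delta>_def using N x d1 by (simp add: powr_minus field_simps)
          moreover have "x / real (d ^ r) = x * real d powr (- real r)"
            unfolding dr using d1 by (simp add: powr_minus field_simps)
          ultimately show ?thesis by (auto elim: near_int_mono)
        qed
        finally show ?thesis unfolding \<phi>_def
          using d alpha by (intro mult_mono powr_mono2) auto
      qed
      have "(\<Sum>n | N < real n \<and> real n \<le> 2 * N. \<phi> n) \<le>
        (\<Sum>n | N < real n \<and> real n \<le> 2 * N. (2 * N) powr \<alpha> * of_bool (near_int \<delta> (x * real n powr (- real r))))"
        by (intro sum_mono dle) auto
      also have "\<dots> = (2 * N) powr \<alpha> * real (card {n. N < real n \<and> real n \<le> 2 * N \<and> near_int \<delta> (x * real n powr (- real r))})"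
        by (simp add: sum_distrib_left[symmetric] Int_def conj_ac)
      also have "\<dots> \<le> (2 * N powr \<alpha>) * (K * (N * \<delta> + N powr ((k + real r * k) / (k + 1)) * (x * N powr (- real r - 1)) powr (k / (k + 1))
          + N powr (real r + 1) / x))"
      proof (intro mult_mono K)
        have "2 powr \<alpha> \<le> (2::real)" using powr_mono[of \<alpha> 1 2] alpha by simp
        then show "(2 * N) powr \<alpha> \<le> 2 * N powr \<alpha>" using N by (simp add: powr_mult mult_right_mono)
      qed (use N x in \<open>auto simp: \<delta>_def\<close>)
      also have "N powr ((k + real r * k) / (k + 1)) * (x * N powr (- real r - 1)) powr (k / (k + 1)) = x powr \<kappa>"
      proof -
        \<comment> \<open>The relation \<open>l = r * k\<close> enters here:
          \<open>k + l = (r + 1) * k\<close>, and the powers of \<open>N\<close> cancel.\<close>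
        have "(k + real r * k) / (k + 1) + (- real r - 1) * \<kappa> = 0"
          using k by (simp add: \<kappa>_def field_simps)
        moreover have "N powr ((k + real r * k) / (k + 1)) * (x * N powr (- real r - 1)) powr (k / (k + 1))
          = x powr \<kappa> * N powr ((k + real r * k) / (k + 1) + (- real r - 1) * \<kappa>)"
          unfolding \<kappa>_def[symmetric] using N x by (simp add: powr_mult powr_powr powr_add mult_ac)
        ultimately show ?thesis using N by simp
      qed
      also have "2 * N powr \<alpha> * (K * (N * \<delta> + x powr \<kappa> + N powr (real r + 1) / x))
         = 2 * K * (N powr \<alpha> * (N * \<delta>) + N powr \<alpha> * (x powr \<kappa> + N powr (real r + 1) / x))"
        by (simp add: algebra_simps)
      also have "\<dots> \<le> 2 * K * (D powr (1 + \<alpha>) * (1/2) ^ j + N powr \<alpha> * (x powr \<kappa> + x powr \<kappa>))"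
      proof (intro mult_left_mono add_mono)
        have "N powr (real r + 1) \<le> X powr (real r + 1)" using N NX by (intro powr_mono2) auto
        then have "N powr (real r + 1) / x \<le> 1" using x by (simp add: Xr)
        also have "\<dots> \<le> x powr \<kappa>" using x \<kappa> by (intro ge_one_powr_ge_zero) auto
        finally show "N powr (real r + 1) / x \<le> x powr \<kappa>" .
        have "N powr \<alpha> * (N * \<delta>) = x * N powr (1 + \<alpha> - 2 * real r)"
          using N by (simp add: \<delta>_def powr_add powr_diff powr_minus field_simps)
        also have "\<dots> = x * D powr (1 + \<alpha> - 2 * real r) * (2 ^ j) powr (1 + \<alpha> - 2 * real r)"
          using D1 by (simp add: N_def powr_mult)
        also have "x * D powr (1 + \<alpha> - 2 * real r) = D powr (1 + \<alpha>)"
          using D1 D2r x by (simp add: powr_diff)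
        \<comment> \<open>The exponent \<open>1 + \<alpha> - 2 * real r\<close> is at most
          \<open>-2\<close>; bounding it by \<open>-1\<close> already gives a convergent geometric
          series in \<open>j\<close>.\<close>
        also have "D powr (1 + \<alpha>) * (2 ^ j) powr (1 + \<alpha> - 2 * real r) \<le> D powr (1 + \<alpha>) * (2 ^ j) powr (-1)"
          using r alpha by (intro mult_left_mono powr_mono) auto
        also have "(2 ^ j) powr (-1) = (1/2::real) ^ j"
          by (subst powr_neg_one) (simp_all add: power_one_over)
        finally show "N powr \<alpha> * (N * \<delta>) \<le> D powr (1 + \<alpha>) * (1/2) ^ j" .
      qed (use K0 in auto)
      finally show ?thesis by (simp add: N_def mult_ac)
    qed
    \<comment> \<open>Completing the last block is harmless: the terms are nonnegative, and
      \<open>block\<close> only needs the left end of a block to be at most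
      \<open>X\<close>.\<close>
    have "(\<Sum>d | D < real d \<and> real d \<le> X. \<phi> d) \<le> (\<Sum>d | D < real d \<and> real d \<le> D * 2 ^ J. \<phi> d)"
      using J(1) by (intro sum_mono2) (auto simp: \<phi>_def)
    also have "\<dots> = (\<Sum>j<J. \<Sum>n | D * 2 ^ j < real n \<and> real n \<le> 2 * (D * 2 ^ j). \<phi> n)"
      using D1 by (intro sum_dyadic_blocks) auto
    also have "\<dots> \<le> (\<Sum>j<J. 2 * K * (D powr (1 + \<alpha>) * (1/2) ^ j + 2 * x powr \<kappa> * (D * 2 ^ j) powr \<alpha>))"
      by (intro sum_mono block) auto
    also have "\<dots> = 2 * K * (D powr (1 + \<alpha>) * (\<Sum>j<J. (1/2) ^ j) + 2 * x powr \<kappa> * (\<Sum>j<J. (D * 2 ^ j) powr \<alpha>))"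
      by (simp add: sum_distrib_left[symmetric] sum.distrib)
    also have "\<dots> \<le> 2 * K * (D powr (1 + \<alpha>) * 2 + 2 * x powr \<kappa> * (K' * X powr \<alpha> * L))"
    proof (intro mult_left_mono add_mono)
      show "(\<Sum>j<J. (1/2::real) ^ j) \<le> 2"
        by (subst geometric_sum) auto
      show "(\<Sum>j<J. (D * 2 ^ j) powr \<alpha>) \<le> K' * X powr \<alpha> * L"
        unfolding L_def using D1 x Xx J by (intro K') auto
    qed (use K0 in auto)
    also have "\<dots> = 4 * K * (D powr (1 + \<alpha>) + K' * (X powr \<alpha> * x powr \<kappa> * L))"
      by (simp add: algebra_simps)
    also have "\<dots> \<le> 4 * K * ((K' + 1) * D powr (1 + \<alpha>) + (K' + 1) * (X powr \<alpha> * x powr \<kappa> * L))"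
      using K0 K'0 L by (intro mult_left_mono add_mono mult_right_mono) (auto simp: algebra_simps)
    also have "\<dots> = 4 * K * (K' + 1) * (X powr \<alpha> * x powr \<kappa> * L + D powr (1 + \<alpha>))"
      by (simp add: algebra_simps)
    also have "X powr \<alpha> * x powr \<kappa> = x powr (\<alpha> / (real r + 1) + k / (k + 1))"
      by (simp add: X_def \<kappa>_def powr_powr powr_add)
    also have "D powr (1 + \<alpha>) = x powr ((1 + \<alpha>) / (2 * real r))"
      by (simp add: D_def powr_powr)
    finally show ?thesis by (simp add: D_def X_def L_def \<phi>_def)
  qed
  moreover have "4 * K * (K' + 1) \<ge> 0" using K0 K'0 by simp
  ultimately show ?thesis by blast
qed

section \<open>The range of \<open>d\<close> beyond \<open>x powr (1 / (r + 1))\<close>\<close>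

text \<open>With \<open>u = (x / n) powr (1 / r)\<close> one has
  \<open>d ^ r \<le> u ^ r < d ^ r + 1\<close>, hence
  \<open>(u - d) * u ^ (r - 1) \<le> u ^ r - d ^ r < 1\<close>. Dividing by
  \<open>u ^ (r - 1)\<close> gives a tolerance free of \<open>d\<close>, so that \<open>n\<close>
  alone can be counted.\<close>

lemma near_int_root_of_floor_eq_power:
  fixes r d n :: nat and x :: real
  assumes r: "r \<ge> 1" and d: "d \<ge> 1" and x: "x \<ge> 0" and n: "n \<in> floor_fibre x (d ^ r)"
  shows "real d \<le> (x / real n) powr (1 / real r)"
    and "near_int ((x / real n) powr (1 / real r - 1)) ((x / real n) powr (1 / real r))"
proof -
  have n1: "n \<ge> 1" and le: "real n * real (d ^ r) \<le> x" and less: "x < real n * (real (d ^ r) + 1)"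
    using n mem_floor_fibre_iff[of "d ^ r" x n] d x by auto
  define t where "t = x / real n"
  define u where "u = t powr (1 / real r)"
  have dt: "real d ^ r \<le> t" "t < real d ^ r + 1"
    using le less n1 by (auto simp: t_def field_simps)
  have "0 < real d ^ r" using d by simp
  with dt(1) have t0: "t > 0" by linarith
  have u0: "u > 0" using t0 by (simp add: u_def)
  have "u ^ r = u powr real r" using u0 by (simp add: powr_realpow)
  also have "\<dots> = t" using t0 r by (simp add: u_def powr_powr)
  finally have ur: "u ^ r = t" .
  have "real d \<le> u"
    using dt(1) u0 r power_mono_iff[of "real d" u r] by (simp add: ur)
  then show du: "real d \<le> (x / real n) powr (1 / real r)"
    by (simp add: u_def t_def)
  have "(u - real d) * u ^ (r - 1) \<le> u ^ r - real d ^ r"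
  proof -
    have "real d ^ (r - 1) * real d \<le> u ^ (r - 1) * real d"
      using du u0 by (intro mult_right_mono power_mono) (auto simp: u_def t_def)
    then show ?thesis using r by (cases r) (auto simp: algebra_simps)
  qed
  also have "\<dots> < 1" using dt by (simp add: ur)
  finally have "u - real d \<le> 1 / u ^ (r - 1)" using u0 by (simp add: field_simps)
  also have "\<dots> = t powr (1 / real r - 1)"
  proof -
    have "1 / u ^ (r - 1) = u / u ^ r" using u0 r by (cases r) auto
    also have "\<dots> = t powr (1 / real r - 1)" unfolding ur using t0 by (simp add: u_def powr_diff)
    finally show ?thesis .
  qed
  finally have "\<bar>u - of_int (int d)\<bar> \<le> t powr (1 / real r - 1)"
    using du by (simp add: u_def t_def)
  then show "near_int ((x / real n) powr (1 / real r - 1)) ((x / real n) powr (1 / real r))"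
    unfolding near_int_def u_def t_def by blast
qed

text \<open>After interchanging the sums, each \<open>n\<close> lies in at most one fibre over an
  \<open>r\<close>-th power, and \<open>X < d\<close> with
  \<open>n * d ^ r \<le> x = X ^ (r + 1)\<close> forces \<open>n \<le> X\<close>. What remains is a
  count of \<open>n\<close> with \<open>(x / n) powr (1 / r)\<close> near an integer, weighted by
  \<open>(x / n) powr (\<alpha> / r)\<close>, an upper bound for
  \<open>d powr \<alpha>\<close>.\<close>

lemma sum_card_fibres_large_le:
  fixes r :: nat and \<alpha> k :: real
  assumes r: "r \<ge> 2" and alpha: "0 \<le> \<alpha>" "\<alpha> \<le> 1 / (2 * real r - 1)"
    and ep: "exponent_pair k (real r * k)"
  shows "\<exists>K\<ge>0. \<forall>x\<ge>2.
    (\<Sum>d | d \<in> {1..nat \<lfloor>x\<rfloor>} \<and> x powr (1 / (real r + 1)) < real d.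
        real d powr \<alpha> * real (card (floor_fibre x (d ^ r))))
    \<le> K * x powr (\<alpha> / (real r + 1) + k / (k + 1))"
proof -
  have k: "k \<ge> 0" "1 / 2 \<le> real r * k" using ep by (auto simp: exponent_pair_def)
  define \<kappa> where "\<kappa> = k / (k + 1)"
  define \<rho> where "\<rho> = 1 / real r"
  define E where "E = \<alpha> / (real r + 1) + \<kappa>"
  have r\<rho>: "real r * \<rho> = 1" using r by (simp add: \<rho>_def)
  have \<rho>: "0 < \<rho>" "\<rho> \<le> 1 / 2" using r by (auto simp: \<rho>_def field_simps)
  \<comment> \<open>The condition \<open>l \<ge> 1 / 2\<close> says
    \<open>k \<ge> 1 / (2 * r)\<close>, and \<open>k / (k + 1)\<close> increases with
    \<open>k\<close>.\<close>
  have \<kappa>: "\<kappa> \<ge> 1 / (2 * real r + 1)" using k by (simp add: \<kappa>_def field_simps)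
  then have \<kappa>0: "\<kappa> > 0" by (rule less_le_trans[rotated]) simp
  have a3: "\<alpha> \<le> 1 / 3"
  proof -
    have "1 / (2 * real r - 1) \<le> 1 / 3" using r by (intro divide_left_mono) auto
    with alpha show ?thesis by linarith
  qed
  have \<alpha>\<rho>: "\<alpha> * \<rho> \<le> 1 / 6" "0 \<le> \<alpha> * \<rho>" using mult_mono[OF a3 \<rho>(2)] alpha \<rho> by auto
  \<comment> \<open>Each of the three terms of the counting bound, weighted by \<open>(x / M) powr (\<alpha> / r)\<close>, is of the form
    \<open>x powr p * M powr q\<close> with \<open>q > 0\<close>, so that the top block \<open>M = x powr (1 / (r + 1))\<close> dominates.\<close>
  define q1 where "q1 = 2 - \<rho> - \<alpha> * \<rho>"
  define p1 where "p1 = \<rho> - 1 + \<alpha> * \<rho>"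
  define q2 where "q2 = (real r + 1) * \<kappa> - (\<rho> + 1) * \<kappa> - \<alpha> * \<rho>"
  define p2 where "p2 = \<alpha> * \<rho> + \<rho> * \<kappa>"
  define q3 where "q3 = \<rho> + 1 - \<alpha> * \<rho>"
  define p3 where "p3 = \<alpha> * \<rho> - \<rho>"
  have q1: "q1 > 0" and q3: "q3 > 0" using \<rho> \<alpha>\<rho> by (auto simp: q1_def q3_def)
  \<comment> \<open>Here \<open>q2 = \<rho> * ((r^2 - 1) * \<kappa> - \<alpha>)\<close>, so the
    claim is \<open>\<alpha> < (r^2 - 1) * \<kappa>\<close>; it follows from
    \<open>\<alpha> \<le> 1 / 3\<close> and the lower bound for \<open>\<kappa>\<close>.\<close>
  have q2: "q2 > 0"
  proof -
    have "1 / 3 < (real r ^ 2 - 1) * (1 / (2 * real r + 1))"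
    proof -
      have "2 * real r \<le> real r ^ 2" using r by (simp add: power2_eq_square)
      moreover have "2 * R + 1 < 3 * (Q - 1)" if "2 * R \<le> Q" "2 \<le> R" for R Q :: real
        using that by argo
      ultimately have "2 * real r + 1 < 3 * (real r ^ 2 - 1)" using r by simp
      then show ?thesis by (simp add: field_simps)
    qed
    also have "\<dots> \<le> (real r ^ 2 - 1) * \<kappa>" using r \<kappa> by (intro mult_left_mono) auto
    finally have "\<alpha> < (real r ^ 2 - 1) * \<kappa>" using a3 by linarith
    then have "\<alpha> * \<rho> < (real r ^ 2 - 1) * \<kappa> * \<rho>" using \<rho> by simp
    also have "\<dots> = real r * (real r * \<rho>) * \<kappa> - \<rho> * \<kappa>" by (simp add: power2_eq_square algebra_simps)
    also have "\<dots> = real r * \<kappa> - \<rho> * \<kappa>" by (simp only: r\<rho> mult_1_right)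
    finally show ?thesis by (simp add: q2_def algebra_simps)
  qed
  \<comment> \<open>At \<open>M = x powr (1 / (r + 1))\<close> the term
    \<open>x powr p * M powr q\<close> has exponent \<open>p + q / (r + 1)\<close>. This equals
    \<open>E\<close> for the exponent pair term and is at most \<open>E - \<kappa>\<close> for the
    other two.\<close>
  have combine: "p + q / (real r + 1) = (p * (real r + 1) + q) / (real r + 1)" for p q
    by (simp add: add_divide_distrib)
  have e1: "p1 + q1 / (real r + 1) \<le> E"
  proof -
    have "p1 * (real r + 1) + q1 = 2 + \<alpha> - real r"
      unfolding p1_def q1_def using r\<rho> by algebra
    then have "p1 + q1 / (real r + 1) \<le> \<alpha> / (real r + 1)"
      using r by (simp add: combine divide_right_mono)
    then show ?thesis using \<kappa>0 by (simp add: E_def)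
  qed
  have e2: "p2 + q2 / (real r + 1) = E"
  proof -
    have "p2 * (real r + 1) + q2 = \<alpha> + \<kappa> * (real r + 1)"
      unfolding p2_def q2_def using r\<rho> by algebra
    then show ?thesis by (simp add: combine E_def add_divide_distrib)
  qed
  have e3: "p3 + q3 / (real r + 1) \<le> E"
  proof -
    have "p3 * (real r + 1) + q3 = \<alpha>"
      unfolding p3_def q3_def using r\<rho> by algebra
    then show ?thesis using \<kappa>0 by (simp add: combine E_def)
  qed
  \<comment> \<open>This serves \<open>n = 1\<close>, which lies in no block
    \<open>2 ^ j < n \<le> 2 * 2 ^ j\<close> and contributes at most
    \<open>x powr (\<alpha> * \<rho>)\<close>.\<close>
  have e0: "\<alpha> * \<rho> \<le> E"
  proof -
    have "0 \<le> q2 / (real r + 1)" "0 \<le> \<rho> * \<kappa>" using q2 \<rho> \<kappa>0 by auto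
    then show ?thesis using e2 by (simp add: p2_def)
  qed
  obtain K where K0: "K \<ge> 0" and K: "\<And>N c \<delta>. N \<ge> 1 \<Longrightarrow> c > 0 \<Longrightarrow> \<delta> \<ge> 0 \<Longrightarrow>
    real (card {n. N < real n \<and> real n \<le> 2 * N \<and> near_int \<delta> (c * real n powr (- \<rho>))})
     \<le> K * (N * \<delta> + N powr ((k + real r * k) / (k + 1)) * (c * N powr (- \<rho> - 1)) powr (k / (k + 1))
          + N powr (\<rho> + 1) / c)"
    using card_near_int_powr_le[OF ep \<rho>(1)] by auto
  obtain K1 where K1: "K1 \<ge> 0" "\<And>X J. (\<forall>j<J. 1 * 2 ^ j \<le> X) \<Longrightarrow> (\<Sum>j<J. (1 * 2 ^ j) powr q1) \<le> K1 * X powr q1"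
    using sum_dyadic_powr_le[OF q1] zero_less_one by metis
  obtain K2 where K2: "K2 \<ge> 0" "\<And>X J. (\<forall>j<J. 1 * 2 ^ j \<le> X) \<Longrightarrow> (\<Sum>j<J. (1 * 2 ^ j) powr q2) \<le> K2 * X powr q2"
    using sum_dyadic_powr_le[OF q2] zero_less_one by metis
  obtain K3 where K3: "K3 \<ge> 0" "\<And>X J. (\<forall>j<J. 1 * 2 ^ j \<le> X) \<Longrightarrow> (\<Sum>j<J. (1 * 2 ^ j) powr q3) \<le> K3 * X powr q3"
    using sum_dyadic_powr_le[OF q3] zero_less_one by metis
  have "(\<Sum>d | d \<in> {1..nat \<lfloor>x\<rfloor>} \<and> x powr (1 / (real r + 1)) < real d.
        real d powr \<alpha> * real (card (floor_fibre x (d ^ r))))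
    \<le> (1 + K * (2 * K1 + K2 + K3)) * x powr E"
    if x: "x \<ge> 2" for x :: real
  proof -
    define X where "X = x powr (1 / (real r + 1))"
    have X0: "X > 0" using x by (simp add: X_def)
    have "X powr (real r + 1) = x" using x by (simp add: X_def powr_powr)
    then have Xr: "X ^ (r + 1) = x" using powr_realpow[OF X0, of "r + 1"] by (simp add: add.commute)
    obtain J where J: "X \<le> 1 * 2 ^ J" "\<forall>j<J. 1 * 2 ^ j \<le> X"
      using dyadic_cover[of 1 X] by auto
    define P where "P = (\<lambda>n. near_int ((x / real n) powr (\<rho> - 1)) ((x / real n) powr \<rho>))"
    define \<phi> where "\<phi> = (\<lambda>n. (x / real n) powr (\<alpha> * \<rho>) * of_bool (P n))"
    define S where "S = {d. d \<in> {1..nat \<lfloor>x\<rfloor>} \<and> X < real d}"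
    have finS: "finite S" by (simp add: S_def)
    have inner: "(\<Sum>d\<in>S. if nat \<lfloor>x / real n\<rfloor> = d ^ r then real d powr \<alpha> else 0)
        \<le> (if real n \<le> X then \<phi> n else 0)" if n: "n \<in> {1..nat \<lfloor>x\<rfloor>}" for n
    proof (cases "\<exists>d\<in>S. nat \<lfloor>x / real n\<rfloor> = d ^ r")
      case True
      then obtain d where d: "d \<in> S" "nat \<lfloor>x / real n\<rfloor> = d ^ r" by blast
      have d1: "d \<ge> 1" "X < real d" using d(1) by (auto simp: S_def)
      have nf: "n \<in> floor_fibre x (d ^ r)" using n d by (simp add: floor_fibre_def)
      have "(nat \<lfloor>x / real n\<rfloor> = d' ^ r) = (d = d')" for d'
        unfolding d(2) using r by (auto dest: power_eq_imp_eq_base)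
      then have "(\<Sum>d\<in>S. if nat \<lfloor>x / real n\<rfloor> = d ^ r then real d powr \<alpha> else 0) = real d powr \<alpha>"
        using finS d(1) by simp
      also have "\<dots> \<le> ((x / real n) powr \<rho>) powr \<alpha>"
        using near_int_root_of_floor_eq_power(1)[OF _ d1(1) _ nf] r x alpha
        by (intro powr_mono2) (auto simp: \<rho>_def)
      also have "\<dots> = \<phi> n"
        using near_int_root_of_floor_eq_power(2)[OF _ d1(1) _ nf] r x
        by (simp add: \<phi>_def P_def powr_powr \<rho>_def)
      finally have le: "(\<Sum>d\<in>S. if nat \<lfloor>x / real n\<rfloor> = d ^ r then real d powr \<alpha> else 0) \<le> \<phi> n" .
      have "real n \<le> X"
      proof (rule ccontr)
        assume "\<not> real n \<le> X"
        then have "X * X ^ r < real n * real d ^ r"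
          using X0 d1 r by (intro mult_strict_mono power_strict_mono) auto
        also have "\<dots> \<le> x" using nf d1 x mem_floor_fibre_iff[of "d ^ r" x n] by simp
        finally show False using Xr by simp
      qed
      with le show ?thesis by simp
    next
      case False
      then have "(\<Sum>d\<in>S. if nat \<lfloor>x / real n\<rfloor> = d ^ r then real d powr \<alpha> else 0) = 0"
        by (intro sum.neutral) auto
      then show ?thesis by (simp add: \<phi>_def)
    qed
    have block: "(\<Sum>n | 1 * 2 ^ j < real n \<and> real n \<le> 2 * (1 * 2 ^ j). \<phi> n)
      \<le> K * (2 * x powr p1 * (1 * 2 ^ j) powr q1 + x powr p2 * (1 * 2 ^ j) powr q2 + x powr p3 * (1 * 2 ^ j) powr q3)" for j
    proof -
      define M :: real where "M = 1 * 2 ^ j"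
      have M: "M \<ge> 1" by (simp add: M_def)
      \<comment> \<open>As \<open>\<rho> - 1\<close> is negative, the tolerance is largest at the
        right end \<open>2 * M\<close> of the block, whereas the weight is largest at the left end
        \<open>M\<close>.\<close>
      define \<delta> where "\<delta> = (x / (2 * M)) powr (\<rho> - 1)"
      have nle: "\<phi> n \<le> (x / M) powr (\<alpha> * \<rho>) * of_bool (near_int \<delta> (x powr \<rho> * real n powr (- \<rho>)))"
        if n: "M < real n" "real n \<le> 2 * M" for n
      proof -
        have "(x / real n) powr (\<rho> - 1) \<le> \<delta>" unfolding \<delta>_def
          using n M x \<rho> by (intro powr_mono2') (auto intro!: divide_left_mono)
        moreover have "(x / real n) powr \<rho> = x powr \<rho> * real n powr (- \<rho>)"
          using x n M by (simp add: powr_divide powr_minus_divide)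
        ultimately have "of_bool (P n) \<le> (of_bool (near_int \<delta> (x powr \<rho> * real n powr (- \<rho>))) :: real)"
          by (auto simp: P_def elim: near_int_mono)
        then show ?thesis unfolding \<phi>_def
          using n M x \<alpha>\<rho> by (intro mult_mono powr_mono2 divide_left_mono) auto
      qed
      have "(\<Sum>n | M < real n \<and> real n \<le> 2 * M. \<phi> n) \<le>
        (\<Sum>n | M < real n \<and> real n \<le> 2 * M. (x / M) powr (\<alpha> * \<rho>) * of_bool (near_int \<delta> (x powr \<rho> * real n powr (- \<rho>))))"
        by (intro sum_mono nle) auto
      also have "\<dots> = (x / M) powr (\<alpha> * \<rho>) * real (card {n. M < real n \<and> real n \<le> 2 * M \<and> near_int \<delta> (x powr \<rho> * real n powr (- \<rho>))})"
        by (simp add: sum_distrib_left[symmetric] Int_def conj_ac)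
      also have "\<dots> \<le> (x / M) powr (\<alpha> * \<rho>) * (K * (M * \<delta> + M powr ((k + real r * k) / (k + 1)) * (x powr \<rho> * M powr (- \<rho> - 1)) powr (k / (k + 1))
          + M powr (\<rho> + 1) / x powr \<rho>))"
        using M x by (intro mult_left_mono K) (auto simp: \<delta>_def)
      also have "\<dots> = K * ((x / M) powr (\<alpha> * \<rho>) * (M * \<delta>) + (x / M) powr (\<alpha> * \<rho>) * (M powr ((k + real r * k) / (k + 1)) * (x powr \<rho> * M powr (- \<rho> - 1)) powr (k / (k + 1)))
          + (x / M) powr (\<alpha> * \<rho>) * (M powr (\<rho> + 1) / x powr \<rho>))"
        by (simp add: algebra_simps)
      also have "\<dots> \<le> K * (2 * x powr p1 * M powr q1 + x powr p2 * M powr q2 + x powr p3 * M powr q3)"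
      proof (intro mult_left_mono add_mono K0)
        have *: "M * \<delta> = 2 powr (1 - \<rho>) * (x powr (\<rho> - 1) * M powr (2 - \<rho>))"
        proof -
          have "M * \<delta> = M powr 1 * (x powr (\<rho> - 1) * 2 powr (1 - \<rho>) * M powr (1 - \<rho>))"
            using M x by (simp add: \<delta>_def powr_divide powr_mult powr_diff mult_ac)
          also have "\<dots> = 2 powr (1 - \<rho>) * (x powr (\<rho> - 1) * (M powr 1 * M powr (1 - \<rho>)))"
            by (simp only: mult_ac)
          also have "M powr 1 * M powr (1 - \<rho>) = M powr (2 - \<rho>)"
            by (simp only: powr_add[symmetric]) simp
          finally show ?thesis .
        qed
        have "2 powr (1 - \<rho>) \<le> (2::real)" using powr_mono[of "1 - \<rho>" 1 2] \<rho> by simp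
        then have "M * \<delta> \<le> 2 * (x powr (\<rho> - 1) * M powr (2 - \<rho>))"
          unfolding * by (intro mult_right_mono) auto
        then have "(x / M) powr (\<alpha> * \<rho>) * (M * \<delta>) \<le> (x / M) powr (\<alpha> * \<rho>) * (2 * (x powr (\<rho> - 1) * M powr (2 - \<rho>)))"
          by (intro mult_left_mono) auto
        also have "\<dots> = 2 * x powr p1 * M powr q1"
          using x M by (simp add: p1_def q1_def powr_divide powr_add powr_diff mult_ac)
        finally show "(x / M) powr (\<alpha> * \<rho>) * (M * \<delta>) \<le> 2 * x powr p1 * M powr q1" .
        have eq1: "(k + real r * k) / (k + 1) = (real r + 1) * \<kappa>"
          using k by (simp add: \<kappa>_def field_simps)
        have eq2: "(x powr \<rho> * M powr (- \<rho> - 1)) powr \<kappa> = x powr (\<rho> * \<kappa>) * M powr (- ((\<rho> + 1) * \<kappa>))"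
        proof -
          have "(x powr \<rho> * M powr (- \<rho> - 1)) powr \<kappa> = x powr (\<rho> * \<kappa>) * M powr ((- \<rho> - 1) * \<kappa>)"
            by (simp add: powr_mult powr_powr)
          also have "(- \<rho> - 1) * \<kappa> = - ((\<rho> + 1) * \<kappa>)" by (simp add: algebra_simps)
          finally show ?thesis .
        qed
        show "(x / M) powr (\<alpha> * \<rho>) * (M powr ((k + real r * k) / (k + 1)) * (x powr \<rho> * M powr (- \<rho> - 1)) powr (k / (k + 1)))
          \<le> x powr p2 * M powr q2"
          unfolding \<kappa>_def[symmetric] eq1 eq2 p2_def q2_def using x M
          by (simp add: powr_divide powr_add powr_diff powr_minus_divide mult_ac)
        show "(x / M) powr (\<alpha> * \<rho>) * (M powr (\<rho> + 1) / x powr \<rho>) \<le> x powr p3 * M powr q3"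
          using x M by (simp add: p3_def q3_def powr_divide powr_add powr_diff divide_simps mult_ac)
      qed
      finally show ?thesis unfolding M_def .
    qed
    have "(\<Sum>d\<in>S. real d powr \<alpha> * real (card (floor_fibre x (d ^ r)))) =
      (\<Sum>d\<in>S. \<Sum>n\<in>{1..nat \<lfloor>x\<rfloor>}. if nat \<lfloor>x / real n\<rfloor> = d ^ r then real d powr \<alpha> else 0)"
      by (intro sum.cong refl) (simp add: floor_fibre_def sum.If_cases Int_def mult.commute)
    also have "\<dots> = (\<Sum>n\<in>{1..nat \<lfloor>x\<rfloor>}. \<Sum>d\<in>S. if nat \<lfloor>x / real n\<rfloor> = d ^ r then real d powr \<alpha> else 0)"
      by (rule sum.swap)
    also have "\<dots> \<le> (\<Sum>n\<in>{1..nat \<lfloor>x\<rfloor>}. if real n \<le> X then \<phi> n else 0)"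
      by (intro sum_mono inner)
    also have "\<dots> = (\<Sum>n | n \<in> {1..nat \<lfloor>x\<rfloor>} \<and> real n \<le> X. \<phi> n)"
      by (rule sum.inter_filter[symmetric]) simp
    also have "\<dots> \<le> (\<Sum>n\<in>insert 1 {n. 1 < real n \<and> real n \<le> 1 * 2 ^ J}. \<phi> n)"
    proof (rule sum_mono2)
      show "{n. n \<in> {1..nat \<lfloor>x\<rfloor>} \<and> real n \<le> X} \<subseteq> insert 1 {n. 1 < real n \<and> real n \<le> 1 * 2 ^ J}"
      proof
        fix n assume n: "n \<in> {n. n \<in> {1..nat \<lfloor>x\<rfloor>} \<and> real n \<le> X}"
        then have "real n \<le> 1 * 2 ^ J" using J(1) by (simp only: mem_Collect_eq) linarith
        then show "n \<in> insert 1 {n. 1 < real n \<and> real n \<le> 1 * 2 ^ J}" using n by (cases "n = 1") auto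
      qed
    qed (simp_all only: finite_insert finite_nat_block, auto simp: \<phi>_def)
    also have "\<dots> = \<phi> 1 + (\<Sum>n | 1 < real n \<and> real n \<le> 1 * 2 ^ J. \<phi> n)"
      by (rule sum.insert) auto
    also have "(\<Sum>n | 1 < real n \<and> real n \<le> 1 * 2 ^ J. \<phi> n) =
      (\<Sum>j<J. \<Sum>n | 1 * 2 ^ j < real n \<and> real n \<le> 2 * (1 * 2 ^ j). \<phi> n)"
      by (intro sum_dyadic_blocks) auto
    also have "\<dots> \<le> (\<Sum>j<J. K * (2 * x powr p1 * (1 * 2 ^ j) powr q1 + x powr p2 * (1 * 2 ^ j) powr q2 + x powr p3 * (1 * 2 ^ j) powr q3))"
      by (intro sum_mono block)
    also have "\<dots> = K * (2 * x powr p1 * (\<Sum>j<J. (1 * 2 ^ j) powr q1) + x powr p2 * (\<Sum>j<J. (1 * 2 ^ j) powr q2) + x powr p3 * (\<Sum>j<J. (1 * 2 ^ j) powr q3))"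
      by (simp only: sum_distrib_left[symmetric] sum.distrib)
    also have "\<dots> \<le> K * (2 * x powr p1 * (K1 * X powr q1) + x powr p2 * (K2 * X powr q2) + x powr p3 * (K3 * X powr q3))"
      using K0 by (intro mult_left_mono add_mono K1 K2 K3 J(2)) auto
    also have "\<dots> = K * (2 * K1 * x powr (p1 + q1 / (real r + 1)) + K2 * x powr (p2 + q2 / (real r + 1)) + K3 * x powr (p3 + q3 / (real r + 1)))"
      by (simp add: X_def powr_powr powr_add mult_ac)
    also have "\<dots> \<le> K * (2 * K1 * x powr E + K2 * x powr E + K3 * x powr E)"
      using K0 K1(1) K2(1) K3(1) e1 e2 e3 x by (intro mult_left_mono add_mono powr_mono) auto
    also have "\<phi> 1 \<le> x powr E"
    proof -
      have "\<phi> 1 \<le> x powr (\<alpha> * \<rho>)" by (simp add: \<phi>_def)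
      also have "\<dots> \<le> x powr E" using e0 x by (intro powr_mono) auto
      finally show ?thesis .
    qed
    finally show ?thesis by (simp add: S_def X_def algebra_simps)
  qed
  moreover have "1 + K * (2 * K1 + K2 + K3) \<ge> 0" using K0 K1(1) K2(1) K3(1) by simp
  ultimately show ?thesis unfolding E_def \<kappa>_def by blast
qed

subsection \<open>Reduction to fibres over perfect powers\<close>

lemma norm_div_power_le:
  fixes h :: "nat \<Rightarrow> complex" and A \<alpha> :: real
  assumes h: "norm (h d) \<le> A * real d powr \<alpha>" and d: "d \<ge> 1"
  shows "norm (h d / (of_nat (d ^ r) * (of_nat (d ^ r) + 1))) \<le> A * real d powr (\<alpha> - 2 * real r)"
proof -
  have d0: "real d > 0" using d by simp
  have A: "0 \<le> A * real d powr \<alpha>" using h norm_ge_zero[of "h d"] by linarith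
  have q: "real d powr (2 * real r) = real (d ^ r) * real (d ^ r)"
    using d0 by (simp add: powr_add[symmetric] powr_realpow[symmetric])
  have "norm (of_nat (d ^ r) * (of_nat (d ^ r) + 1) :: complex) = real (d ^ r) * (real (d ^ r) + 1)"
  proof -
    have "norm (of_nat q + 1 :: complex) = real q + 1" for q
      using norm_of_nat[of "Suc q", where 'a = complex] by (simp add: add.commute)
    then show ?thesis by (simp only: norm_mult norm_of_nat)
  qed
  then have "norm (h d / (of_nat (d ^ r) * (of_nat (d ^ r) + 1))) = norm (h d) / (real (d ^ r) * (real (d ^ r) + 1))"
    by (simp only: norm_divide)
  also have "\<dots> \<le> (A * real d powr \<alpha>) / (real (d ^ r) * real (d ^ r))"
    using h A d0 by (intro frac_le mult_left_mono) auto
  also have "\<dots> = A * real d powr (\<alpha> - 2 * real r)"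
    unfolding q[symmetric] by (simp add: powr_diff)
  finally show ?thesis .
qed

text \<open>\<open>F i\<close> belongs to \<open>d = i + 1\<close>, so the shift by \<open>m\<close>
  starts at the first integer \<open>d > D\<close>. From there on \<open>d powr (- \<beta>) \<le> D
  powr (2 - \<beta>) / ((d - 1) * d)\<close>, which telescopes to
  \<open>D powr (2 - \<beta>) / m\<close>; \<open>D \<le> 2 * m\<close> gives the factor 2.\<close>

lemma norm_suminf_tail_le:
  fixes F :: "nat \<Rightarrow> complex" and A \<beta> D :: real
  assumes F: "\<And>i. norm (F i) \<le> A * real (Suc i) powr (- \<beta>)" and "\<beta> \<ge> 2" and "A \<ge> 0"
    and D: "1 \<le> D" "real m \<le> D" "D < real m + 1"
  shows "summable F" "norm (\<Sum>i. F (i + m)) \<le> 2 * A * D powr (1 - \<beta>)"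
proof -
  have m: "m \<ge> 1" using D by linarith
  define B where "B = A * D powr (2 - \<beta>)"
  have B: "B \<ge> 0" using assms by (simp add: B_def)
  have "(\<lambda>i. 1 / (real i + real m)) \<longlonglongrightarrow> 0"
    using LIMSEQ_ignore_initial_segment[OF lim_1_over_n, of m] by simp
  then have "(\<lambda>i. 1 / (real i + real m) - 1 / (real (Suc i) + real m)) sums (1 / (real 0 + real m) - 0)"
    by (rule telescope_sums')
  then have sums: "(\<lambda>i. B * (1 / (real i + real m) - 1 / (real (Suc i) + real m))) sums (B * (1 / real m))"
    by (intro sums_mult) simp
  have bound: "norm (F (i + m)) \<le> B * (1 / (real i + real m) - 1 / (real (Suc i) + real m))" for i
  proof -
    define d where "d = real i + real m + 1"
    have d: "d > D" "d > 1" using D m by (auto simp: d_def)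
    have "norm (F (i + m)) \<le> A * d powr (- \<beta>)" using F[of "i + m"] by (simp add: d_def add_ac)
    also have "d powr (- \<beta>) = d powr (2 - \<beta>) * (1 / d^2)"
      using d by (simp add: powr_diff powr_minus field_simps)
    also have "A * (d powr (2 - \<beta>) * (1 / d^2)) \<le> A * (D powr (2 - \<beta>) * (1 / ((d - 1) * d)))"
      using d D assms by (intro mult_left_mono mult_mono powr_mono2' divide_left_mono)
        (auto simp: power2_eq_square)
    also have "1 / ((d - 1) * d) = 1 / (d - 1) - 1 / d"
      using d by (simp add: field_simps)
    finally show ?thesis by (simp add: d_def B_def add_ac mult_ac)
  qed
  have "summable (\<lambda>i. F (i + m))"
    by (rule summable_comparison_test[OF _ sums_summable[OF sums]]) (use bound in blast)
  then show "summable F" by (simp only: summable_iff_shift)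
  have "norm (\<Sum>i. F (i + m)) \<le> (\<Sum>i. B * (1 / (real i + real m) - 1 / (real (Suc i) + real m)))"
    by (rule norm_suminf_le[OF bound sums_summable[OF sums]])
  also have "\<dots> = B * (1 / real m)" using sums by (simp only: sums_iff)
  also have "\<dots> \<le> B * (2 / D)"
  proof (intro mult_left_mono B)
    have "D \<le> 2 * real m" using m D by linarith
    then have "2 / (2 * real m) \<le> 2 / D" using m D(1) by (intro divide_left_mono) auto
    then show "1 / real m \<le> 2 / D" by simp
  qed
  also have "\<dots> = 2 * A * D powr (1 - \<beta>)"
    using D by (simp add: B_def powr_diff power2_eq_square)
  finally show "norm (\<Sum>i. F (i + m)) \<le> 2 * A * D powr (1 - \<beta>)" .
qed

text \<open>Every quotient lies between 1 and \<open>\<lfloor>x\<rfloor>\<close>, so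
  \<open>f\<close> is never evaluated at 0. A quotient of the form \<open>d ^ r\<close> determines
  \<open>d\<close>, and \<open>d \<le> d ^ r\<close> keeps \<open>d\<close> in the same range;
  interchanging the sums groups the \<open>n\<close> by \<open>d\<close>.\<close>

lemma sum_floor_eq_sum_fibres:
  fixes f h :: "nat \<Rightarrow> complex"
  assumes r: "r \<ge> 1"
    and f_pow: "\<forall>d\<ge>1. f (d ^ r) = h d"
    and f_other: "\<forall>n\<ge>1. (\<not> (\<exists>d. n = d ^ r)) \<longrightarrow> f n = 0"
  shows "(\<Sum>n=1..nat \<lfloor>x\<rfloor>. f (nat \<lfloor>x / real n\<rfloor>)) =
    (\<Sum>d=1..nat \<lfloor>x\<rfloor>. h d * of_nat (card (floor_fibre x (d ^ r))))"
proof -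
  define T where "T = nat \<lfloor>x\<rfloor>"
  have f_eq: "f q = (\<Sum>d=1..T. if q = d ^ r then h d else 0)" if q: "1 \<le> q" "q \<le> T" for q
  proof (cases "\<exists>d. q = d ^ r")
    case True
    then obtain d where d: "q = d ^ r" by blast
    have d1: "d \<ge> 1" using q r d by (cases d) (auto simp: zero_power)
    have "d ^ 1 \<le> d ^ r" using d1 r by (intro power_increasing) auto
    then have dT: "d \<in> {1..T}" using q d d1 by auto
    have "(q = d' ^ r) = (d = d')" for d'
      unfolding d using r by (auto dest: power_eq_imp_eq_base)
    then show ?thesis using dT d d1 f_pow by simp
  next
    case False
    then show ?thesis using f_other q by simp
  qed
  have q_range: "1 \<le> nat \<lfloor>x / real n\<rfloor>" "nat \<lfloor>x / real n\<rfloor> \<le> T" if n: "n \<in> {1..T}" for n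
  proof -
    have "real n \<le> x" "x \<ge> 1" using n unfolding T_def by auto linarith+
    then have "1 \<le> x / real n" "x / real n \<le> x" using n by (auto simp: field_simps)
    then show "1 \<le> nat \<lfloor>x / real n\<rfloor>" "nat \<lfloor>x / real n\<rfloor> \<le> T"
      by (auto simp: T_def le_nat_floor intro!: nat_mono floor_mono)
  qed
  have "(\<Sum>n=1..T. f (nat \<lfloor>x / real n\<rfloor>)) =
    (\<Sum>n=1..T. \<Sum>d=1..T. if nat \<lfloor>x / real n\<rfloor> = d ^ r then h d else 0)"
    by (intro sum.cong refl f_eq q_range)
  also have "\<dots> = (\<Sum>d=1..T. \<Sum>n=1..T. if nat \<lfloor>x / real n\<rfloor> = d ^ r then h d else 0)"
    by (rule sum.swap)
  also have "\<dots> = (\<Sum>d=1..T. h d * of_nat (card (floor_fibre x (d ^ r))))"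
    by (intro sum.cong refl) (simp add: floor_fibre_def T_def sum.If_cases Int_def mult.commute)
  finally show ?thesis by (simp add: T_def)
qed

text \<open>The term of index \<open>n\<close> belongs to the integer \<open>n + 1\<close>, so
  \<open>g i = (i + 1) ^ r - 1\<close> is the index that belongs to \<open>d ^ r\<close> with
  \<open>d = i + 1\<close>. All terms outside the range of \<open>g\<close> vanish.\<close>

lemma suminf_power_reindex:
  fixes f h :: "nat \<Rightarrow> complex"
  assumes r: "r \<ge> 1"
    and f_pow: "\<forall>d\<ge>1. f (d ^ r) = h d"
    and f_other: "\<forall>n\<ge>1. (\<not> (\<exists>d. n = d ^ r)) \<longrightarrow> f n = 0"
  shows "(\<Sum>n. f (Suc n) / (of_nat (Suc n) * of_nat (Suc n + 1))) =
    (\<Sum>i. h (Suc i) / (of_nat (Suc i ^ r) * (of_nat (Suc i ^ r) + 1)))"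
proof -
  define g where "g = (\<lambda>i. Suc i ^ r - 1)"
  have gS: "Suc (g i) = Suc i ^ r" for i by (simp add: g_def)
  have "strict_mono g"
  proof (rule strict_monoI)
    fix i j :: nat assume "i < j"
    then have "Suc i ^ r < Suc j ^ r" using r by (intro power_strict_mono) auto
    then show "g i < g j" using gS by (metis Suc_less_eq)
  qed
  moreover have "f (Suc n) / (of_nat (Suc n) * of_nat (Suc n + 1)) = 0" if "n \<notin> range g" for n
  proof -
    have "Suc n \<noteq> d ^ r" for d
    proof
      assume *: "Suc n = d ^ r"
      with r obtain i where "d = Suc i" by (cases d) (auto simp: zero_power)
      then have "n = g i" using * by (simp add: g_def flip: *)
      with that show False by blast
    qed
    then show ?thesis using f_other by simp
  qed
  ultimately have "(\<Sum>n. f (Suc n) / (of_nat (Suc n) * of_nat (Suc n + 1))) =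
    (\<Sum>i. f (Suc (g i)) / (of_nat (Suc (g i)) * of_nat (Suc (g i) + 1)))"
    by (rule suminf_mono_reindex[symmetric])
  also have "\<dots> = (\<Sum>i. h (Suc i) / (of_nat (Suc i ^ r) * (of_nat (Suc i ^ r) + 1)))"
    unfolding gS using f_pow by (simp add: add.commute)
  finally show ?thesis .
qed

section \<open>Splitting the sum over \<open>d\<close> and collecting the errors of the
  ranges\<close>

theorem theorem2:
  fixes r :: nat and h f :: "nat \<Rightarrow> complex" and \<alpha> k l :: real
  assumes r: "r \<ge> 2"
    and alpha: "0 \<le> \<alpha>" "\<alpha> \<le> 1 / (2 * real r - 1)"
    and hbound: "\<exists>A. \<forall>d\<ge>1. norm (h d) \<le> A * real d powr \<alpha>"
    and f_pow: "\<forall>d\<ge>1. f (d ^ r) = h d"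
    and f_other: "\<forall>n\<ge>1. (\<not> (\<exists>d. n = d ^ r)) \<longrightarrow> f n = 0"
    and ep: "exponent_pair k l" and lk: "l = real r * k"
  shows "\<exists>C. \<forall>x::real. x \<ge> 2 \<longrightarrow>
     norm ((\<Sum>n=1..nat \<lfloor>x\<rfloor>. f (nat \<lfloor>x / real n\<rfloor>))
           - (\<Sum>n. f (Suc n) / (of_nat (Suc n) * of_nat (Suc n + 1))) * complex_of_real x)
     \<le> C * (x powr (\<alpha> / (real r + 1) + k / (k + 1)) * (if \<alpha> = 0 then ln x else 1)
            + x powr ((1 + \<alpha>) / (2 * real r)))"
proof -
  obtain A where A: "\<And>d. d \<ge> 1 \<Longrightarrow> norm (h d) \<le> A * real d powr \<alpha>" using hbound by blast
  have "norm (h 1) \<le> A" using A[of 1] by simp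
  then have A0: "A \<ge> 0" using norm_ge_zero[of "h 1"] by linarith
  have "1 / (2 * real r - 1) \<le> 1 / 1" using r by (intro divide_left_mono) auto
  with alpha have alpha1: "\<alpha> \<le> 1" by simp
  have ep': "exponent_pair k (real r * k)" using ep lk by simp
  obtain K where K: "K \<ge> 0" "\<And>x. x \<ge> 2 \<Longrightarrow>
    (\<Sum>d | x powr (1 / (2 * real r)) < real d \<and> real d \<le> x powr (1 / (real r + 1)).
        real d powr \<alpha> * real (card (floor_fibre x (d ^ r))))
    \<le> K * (x powr (\<alpha> / (real r + 1) + k / (k + 1)) * (if \<alpha> = 0 then ln x else 1)
         + x powr ((1 + \<alpha>) / (2 * real r)))"
    using sum_card_fibres_medium_le[OF r alpha(1) alpha1 ep'] by blast
  obtain K' where K': "K' \<ge> 0" "\<And>x. x \<ge> 2 \<Longrightarrow>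
    (\<Sum>d | d \<in> {1..nat \<lfloor>x\<rfloor>} \<and> x powr (1 / (real r + 1)) < real d.
        real d powr \<alpha> * real (card (floor_fibre x (d ^ r))))
    \<le> K' * x powr (\<alpha> / (real r + 1) + k / (k + 1))"
    using sum_card_fibres_large_le[OF r alpha ep'] by blast
  define F where "F = (\<lambda>i. h (Suc i) / (of_nat (Suc i ^ r) * (of_nat (Suc i ^ r) + 1)))"
  have F: "norm (F i) \<le> A * real (Suc i) powr (- (2 * real r - \<alpha>))" for i
    unfolding F_def using norm_div_power_le[of h "Suc i" A \<alpha> r] A[of "Suc i"] by simp
  \<comment> \<open>In the constant, 3 is 1 for the rounding errors with \<open>d \<le> D\<close>
    plus 2 for the tail of the series; \<open>K\<close> and \<open>K' / ln 2\<close> come from the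
    two ranges of larger \<open>d\<close>.\<close>
  have "norm ((\<Sum>n=1..nat \<lfloor>x\<rfloor>. f (nat \<lfloor>x / real n\<rfloor>))
           - (\<Sum>n. f (Suc n) / (of_nat (Suc n) * of_nat (Suc n + 1))) * complex_of_real x)
     \<le> A * (3 + K + K' / ln 2) * (x powr (\<alpha> / (real r + 1) + k / (k + 1)) * (if \<alpha> = 0 then ln x else 1)
            + x powr ((1 + \<alpha>) / (2 * real r)))" if x: "x \<ge> 2" for x :: real
  proof -
    define D where "D = x powr (1 / (2 * real r))"
    define X where "X = x powr (1 / (real r + 1))"
    define T where "T = nat \<lfloor>x\<rfloor>"
    define m where "m = nat \<lfloor>D\<rfloor>"
    define c where "c = (\<lambda>d. real (card (floor_fibre x (d ^ r))))"
    define a where "a = (\<lambda>d. x / (real (d ^ r) * (real (d ^ r) + 1)))"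
    define E where "E = x powr (\<alpha> / (real r + 1) + k / (k + 1))"
    define L where "L = (if \<alpha> = 0 then ln x else 1)"
    define Z where "Z = x powr ((1 + \<alpha>) / (2 * real r))"
    have D1: "D \<ge> 1" using x by (simp add: D_def ge_one_powr_ge_zero)
    have Dx: "D \<le> x" using x r powr_mono[of "1 / (2 * real r)" 1 x] by (simp add: D_def)
    have DZ: "D powr (1 + \<alpha>) = Z" by (simp add: D_def Z_def powr_powr)
    have D2r: "D powr (2 * real r) = x" using x r by (simp add: D_def powr_powr)
    have m: "real m \<le> D" "D < real m + 1" using D1 unfolding m_def by linarith+
    have mT: "m \<le> T" unfolding m_def T_def using Dx by (intro nat_mono floor_mono)
    have tail: "summable F" "norm (\<Sum>i. F (i + m)) \<le> 2 * A * D powr (1 - (2 * real r - \<alpha>))"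
      using norm_suminf_tail_le[OF F _ A0 D1 m] r alpha1 by auto
    have tail': "norm (\<Sum>i. F (i + m)) * x \<le> 2 * A * Z"
    proof -
      have "norm (\<Sum>i. F (i + m)) * x \<le> 2 * A * D powr (1 - (2 * real r - \<alpha>)) * x"
        using tail x by (intro mult_right_mono) auto
      also have "\<dots> = 2 * A * (D powr (1 - (2 * real r - \<alpha>)) * D powr (2 * real r))"
        by (simp add: D2r)
      also have "D powr (1 - (2 * real r - \<alpha>)) * D powr (2 * real r) = Z"
        unfolding DZ[symmetric] by (simp add: powr_add[symmetric])
      finally show ?thesis .
    qed
    have "(\<Sum>n. f (Suc n) / (of_nat (Suc n) * of_nat (Suc n + 1))) = suminf F"
      unfolding F_def using r f_pow f_other by (intro suminf_power_reindex) auto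
    also have "\<dots> = (\<Sum>i. F (i + m)) + (\<Sum>i<m. F i)"
      using tail(1) by (rule suminf_split_initial_segment)
    finally have "(\<Sum>n. f (Suc n) / (of_nat (Suc n) * of_nat (Suc n + 1))) * complex_of_real x =
      (\<Sum>i. F (i + m)) * complex_of_real x + (\<Sum>i<m. F i * complex_of_real x)"
      by (simp add: sum_distrib_right distrib_right)
    also have "(\<Sum>i<m. F i * complex_of_real x) = (\<Sum>d=1..m. h d * complex_of_real (a d))"
      by (intro sum.reindex_bij_witness[of _ "\<lambda>d. d - 1" Suc]) (auto simp: F_def a_def)
    finally have Cf: "(\<Sum>n. f (Suc n) / (of_nat (Suc n) * of_nat (Suc n + 1))) * complex_of_real x =
      (\<Sum>i. F (i + m)) * complex_of_real x + (\<Sum>d=1..m. h d * complex_of_real (a d))" .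
    have "(\<Sum>n=1..nat \<lfloor>x\<rfloor>. f (nat \<lfloor>x / real n\<rfloor>)) = (\<Sum>d=1..T. h d * complex_of_real (c d))"
      using sum_floor_eq_sum_fibres[OF _ f_pow f_other, of x] r by (simp add: T_def c_def)
    also have "{1..T} = {1..m} \<union> {m+1..T}" using mT by auto
    also have "(\<Sum>d\<in>\<dots>. h d * complex_of_real (c d)) =
      (\<Sum>d=1..m. h d * complex_of_real (c d)) + (\<Sum>d=m+1..T. h d * complex_of_real (c d))"
      by (rule sum.union_disjoint) auto
    finally have S: "(\<Sum>n=1..nat \<lfloor>x\<rfloor>. f (nat \<lfloor>x / real n\<rfloor>)) =
      (\<Sum>d=1..m. h d * complex_of_real (c d)) + (\<Sum>d=m+1..T. h d * complex_of_real (c d))" .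
    have "norm ((\<Sum>n=1..nat \<lfloor>x\<rfloor>. f (nat \<lfloor>x / real n\<rfloor>))
           - (\<Sum>n. f (Suc n) / (of_nat (Suc n) * of_nat (Suc n + 1))) * complex_of_real x)
      = norm ((\<Sum>d=1..m. h d * complex_of_real (c d - a d)) + (\<Sum>d=m+1..T. h d * complex_of_real (c d))
        - (\<Sum>i. F (i + m)) * complex_of_real x)"
      unfolding S Cf of_real_diff right_diff_distrib sum_subtractf by (simp only: algebra_simps)
    also have "\<dots> \<le> norm (\<Sum>d=1..m. h d * complex_of_real (c d - a d))
        + norm (\<Sum>d=m+1..T. h d * complex_of_real (c d)) + norm ((\<Sum>i. F (i + m)) * complex_of_real x)"
      by (intro order_trans[OF norm_triangle_ineq4] add_mono norm_triangle_ineq order_refl)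
    also have "norm (\<Sum>d=1..m. h d * complex_of_real (c d - a d)) \<le> A * Z"
    proof -
      have "norm (\<Sum>d=1..m. h d * complex_of_real (c d - a d)) \<le> (\<Sum>d=1..m. A * D powr \<alpha>)"
      proof (rule sum_norm_le)
        fix d assume d: "d \<in> {1..m}"
        have "\<bar>c d - a d\<bar> \<le> 1" unfolding c_def a_def using d x by (intro card_floor_fibre) auto
        moreover have "norm (h d) \<le> A * D powr \<alpha>"
        proof -
          have "norm (h d) \<le> A * real d powr \<alpha>" using A d by simp
          also have "\<dots> \<le> A * D powr \<alpha>"
            using A0 d m alpha by (intro mult_left_mono powr_mono2) auto
          finally show ?thesis .
        qed
        ultimately have "norm (h d) * \<bar>c d - a d\<bar> \<le> (A * D powr \<alpha>) * 1"
          using A0 by (intro mult_mono) auto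
        then show "norm (h d * complex_of_real (c d - a d)) \<le> A * D powr \<alpha>"
          unfolding norm_mult norm_of_real by simp
      qed
      also have "\<dots> = A * (real m * D powr \<alpha>)" by simp
      also have "\<dots> \<le> A * (D * D powr \<alpha>)"
        using A0 m by (intro mult_left_mono mult_right_mono) auto
      also have "D * D powr \<alpha> = Z" unfolding DZ[symmetric] using D1 by (simp add: powr_add)
      finally show ?thesis .
    qed
    \<comment> \<open>Beyond \<open>D\<close> the counts are bounded outright; their main terms
      belong to the tail of the series, which is estimated separately.\<close>
    also have "norm (\<Sum>d=m+1..T. h d * complex_of_real (c d)) \<le> A * (K * (E * L + Z) + K' * E)"
    proof -
      define \<phi> where "\<phi> = (\<lambda>d. real d powr \<alpha> * c d)"
      have "norm (\<Sum>d=m+1..T. h d * complex_of_real (c d)) \<le> (\<Sum>d=m+1..T. A * \<phi> d)"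
      proof (rule sum_norm_le)
        fix d assume "d \<in> {m+1..T}"
        then have "norm (h d) * c d \<le> A * real d powr \<alpha> * c d"
          by (intro mult_right_mono A) (auto simp: c_def)
        then show "norm (h d * complex_of_real (c d)) \<le> A * \<phi> d"
          by (simp add: norm_mult \<phi>_def c_def)
      qed
      also have "\<dots> = A * (\<Sum>d=m+1..T. \<phi> d)" by (simp only: sum_distrib_left)
      also have "(\<Sum>d=m+1..T. \<phi> d) \<le> (\<Sum>d\<in>{d. D < real d \<and> real d \<le> X} \<union> {d. d \<in> {1..T} \<and> X < real d}. \<phi> d)"
        using m by (intro sum_mono2) (auto simp: \<phi>_def c_def)
      also have "\<dots> = (\<Sum>d | D < real d \<and> real d \<le> X. \<phi> d) + (\<Sum>d | d \<in> {1..T} \<and> X < real d. \<phi> d)"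
        by (rule sum.union_disjoint) auto
      also have "\<dots> \<le> K * (E * L + Z) + K' * E"
        using add_mono[OF K(2)[OF x] K'(2)[OF x]]
        unfolding \<phi>_def c_def D_def X_def E_def L_def Z_def T_def .
      finally show ?thesis using A0 by (simp add: mult_left_mono)
    qed
    also have "norm ((\<Sum>i. F (i + m)) * complex_of_real x) \<le> 2 * A * Z"
      using tail' x by (simp add: norm_mult)
    also have "A * Z + A * (K * (E * L + Z) + K' * E) + 2 * A * Z = A * (3 * Z + K * (E * L + Z) + K' * E)"
      by (simp add: algebra_simps)
    also have "\<dots> \<le> A * (3 * (E * L + Z) + K * (E * L + Z) + K' / ln 2 * (E * L + Z))"
    proof (intro mult_left_mono add_mono order_refl A0)
      have EZ: "E \<ge> 0" "Z \<ge> 0" by (auto simp: E_def Z_def)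
      \<comment> \<open>Whether \<open>L\<close> is \<open>ln x\<close> or 1, it is at least
        \<open>ln 2\<close>; this turns the bound \<open>K' * E\<close>, which carries no logarithm,
        into a multiple of \<open>E * L\<close>.\<close>
      have L: "L \<ge> ln 2" using x ln_le_minus_one[of 2] by (auto simp: L_def)
      then have EL: "E * ln 2 \<le> E * L" using EZ by (intro mult_left_mono)
      have "0 \<le> E * L" using EZ L by (intro mult_nonneg_nonneg) (auto intro: order_trans[rotated])
      then show "Z \<le> E * L + Z" by simp
      have "K' * E = K' / ln 2 * (E * ln 2)" by simp
      also have "\<dots> \<le> K' / ln 2 * (E * L + Z)"
        using K' EL EZ by (intro mult_left_mono) auto
      finally show "K' * E \<le> K' / ln 2 * (E * L + Z)" .
    qed (use K in \<open>auto simp: E_def\<close>)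
    also have "\<dots> = A * (3 + K + K' / ln 2) * (E * L + Z)"
      by (simp only: distrib_right mult.assoc)
    finally show ?thesis by (simp add: E_def L_def Z_def)
  qed
  then show ?thesis by blast
qed

end
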